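(* Every quasi-Q-set of a flow on a compact surface is essential.
   Context: A surface is a paracompact two-dimensional manifold, possibly with boundary and not necessarily orientable. A flow $v:\mathbb{R}\times S\to S$ is a continuous $\mathbb{R}$-action; $v_t=v(t,\cdot)$. $O_v(x)$ denotes the orbit of $x$ under $v$. $\omega(x)=\bigcap_{n\in\mathbb{R}}\overline{\{v_t(x)\mid t>n\}}$ and $\alpha(x)=\bigcap_{n\in\mathbb{R}}\overline{\{v_t(x)\mid t<n\}}$. A simple curve $C$ in $S$ is transverse to $v$ at $p$ if there are a surface $T$, a vector field $X$ on $T$ generating a flow $v_X$, and a homeomorphism $h:S\to T$ carrying orbits of $v$ to orbits of $v_X$ preserving time direction, such that $h\circ C$ is a $C^1$ simple curve with $T_{h(p)}T=T_{h(p)}(h\circ C)\oplus T_{h(p)}O_{v_X}(h(p))$. A closed transversal is a simple closed curve transverse to $v$ at each of its points. A subset $A$ of a compact surface $S$ is inessential if, in the closed surface $S^*$ obtained from $S$ by collapsing every boundary component to a point, the resulting subset $A^*$ has a neighborhood that is an open disk; $A$ is essential if it is not inessential. The $\omega$-limit (resp. $\alpha$-limit) set of a point is a quasi-Q-set if it intersects an essential closed transversal infinitely many times. *)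

theory Defs
  imports "HOL-Analysis.Analysis"
begin

section \<open>Surfaces\<close>

definition paracompact_space :: "'a topology \<Rightarrow> bool" where
  "paracompact_space X \<longleftrightarrow>
     (\<forall>\<U>. (\<forall>U\<in>\<U>. openin X U) \<and> \<Union>\<U> = topspace X \<longrightarrow>
        (\<exists>\<V>. (\<forall>V\<in>\<V>. openin X V) \<and> \<Union>\<V> = topspace X \<and>
             (\<forall>V\<in>\<V>. \<exists>U\<in>\<U>. V \<subseteq> U) \<and> locally_finite_in X \<V>))"

text \<open>The model of a surface with boundary is the closed upper half plane; the complex plane
  is used as a real two-dimensional vector space throughout.\<close>

definition half_plane :: "complex set" where
  "half_plane = {z. 0 \<le> Im z}"

type_synonym 'a chart = "'a set \<times> ('a \<Rightarrow> complex)"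

definition surface_chart :: "'a topology \<Rightarrow> 'a chart \<Rightarrow> bool" where
  "surface_chart S c \<longleftrightarrow> (case c of (U, \<phi>) \<Rightarrow>
     openin S U \<and> openin (top_of_set half_plane) (\<phi> ` U) \<and>
     homeomorphic_map (subtopology S U) (top_of_set (\<phi> ` U)) \<phi>)"

text \<open>Connectedness and orientability are not required, and the boundary may be empty.\<close>

definition surface :: "'a topology \<Rightarrow> bool" where
  "surface S \<longleftrightarrow> Hausdorff_space S \<and> paracompact_space S \<and>
     (\<forall>x\<in>topspace S. \<exists>c. surface_chart S c \<and> x \<in> fst c)"

text \<open>A point is interior iff some chart around it has an image that is open in the whole plane.\<close>

definition surface_boundary :: "'a topology \<Rightarrow> 'a set" where
  "surface_boundary S =
     {x \<in> topspace S. \<not> (\<exists>c. surface_chart S c \<and> x \<in> fst c \<and> open (snd c ` fst c))}"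

section \<open>Essential sets\<close>

text \<open>The points of the collapsed surface are the boundary components of \<open>S\<close> and the
  singletons of interior points, so its points are subsets of \<open>S\<close>.\<close>

definition collapse :: "'a topology \<Rightarrow> 'a \<Rightarrow> 'a set" where
  "collapse S x =
     (if x \<in> surface_boundary S
      then connected_component_of_set (subtopology S (surface_boundary S)) x else {x})"

definition collapsed_surface :: "'a topology \<Rightarrow> 'a set topology" where
  "collapsed_surface S = topology (\<lambda>W. W \<subseteq> collapse S ` topspace S \<and>
     openin S {x \<in> topspace S. collapse S x \<in> W})"

lemma openin_collapsed_surface:
  "openin (collapsed_surface S) W \<longleftrightarrow> W \<subseteq> collapse S ` topspace S \<and>
     openin S {x \<in> topspace S. collapse S x \<in> W}"
proof -
  let ?P = "\<lambda>W. W \<subseteq> collapse S ` topspace S \<and> openin S {x \<in> topspace S. collapse S x \<in> W}"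
  have "istopology ?P"
    unfolding istopology_def
  proof (intro conjI allI impI)
    fix V W assume V: "?P V" and W: "?P W"
    show "V \<inter> W \<subseteq> collapse S ` topspace S"
      using V by blast
    have "{x \<in> topspace S. collapse S x \<in> V \<inter> W} =
        {x \<in> topspace S. collapse S x \<in> V} \<inter> {x \<in> topspace S. collapse S x \<in> W}"
      by blast
    then show "openin S {x \<in> topspace S. collapse S x \<in> V \<inter> W}"
      using V W by (simp add: openin_Int)
  next
    fix \<K> assume K: "\<forall>K\<in>\<K>. ?P K"
    show "\<Union>\<K> \<subseteq> collapse S ` topspace S"
      using K by blast
    have "{x \<in> topspace S. collapse S x \<in> \<Union>\<K>} =
        \<Union>((\<lambda>K. {x \<in> topspace S. collapse S x \<in> K}) ` \<K>)"
      by blast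
    then show "openin S {x \<in> topspace S. collapse S x \<in> \<Union>\<K>}"
      using K by (auto intro: openin_Union)
  qed
  then show ?thesis
    by (simp add: collapsed_surface_def)
qed

lemma topspace_collapsed_surface:
  "topspace (collapsed_surface S) = collapse S ` topspace S"
proof (rule subset_antisym)
  show "topspace (collapsed_surface S) \<subseteq> collapse S ` topspace S"
    using openin_collapsed_surface openin_topspace by blast
  have "{x \<in> topspace S. collapse S x \<in> collapse S ` topspace S} = topspace S"
    by blast
  then have "openin (collapsed_surface S) (collapse S ` topspace S)"
    by (simp add: openin_collapsed_surface)
  then show "collapse S ` topspace S \<subseteq> topspace (collapsed_surface S)"
    by (rule openin_subset)
qed

lemma quotient_map_collapse: "quotient_map S (collapsed_surface S) (collapse S)"
  by (simp add: quotient_map_def topspace_collapsed_surface openin_collapsed_surface)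

definition inessential :: "'a topology \<Rightarrow> 'a set \<Rightarrow> bool" where
  "inessential S A \<longleftrightarrow> (\<exists>D. openin (collapsed_surface S) D \<and> collapse S ` A \<subseteq> D \<and>
     subtopology (collapsed_surface S) D homeomorphic_space top_of_set (ball (0::complex) 1))"

definition essential :: "'a topology \<Rightarrow> 'a set \<Rightarrow> bool" where
  "essential S A \<longleftrightarrow> \<not> inessential S A"

section \<open>Flows\<close>

definition flow :: "'a topology \<Rightarrow> (real \<Rightarrow> 'a \<Rightarrow> 'a) \<Rightarrow> bool" where
  "flow S v \<longleftrightarrow>
     continuous_map (prod_topology euclideanreal S) S (\<lambda>(t, x). v t x) \<and>
     (\<forall>x\<in>topspace S. v 0 x = x) \<and>
     (\<forall>s t. \<forall>x\<in>topspace S. v (s + t) x = v s (v t x))"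

definition orbit :: "(real \<Rightarrow> 'a \<Rightarrow> 'a) \<Rightarrow> 'a \<Rightarrow> 'a set" where
  "orbit v x = range (\<lambda>t. v t x)"

definition omega_limit :: "'a topology \<Rightarrow> (real \<Rightarrow> 'a \<Rightarrow> 'a) \<Rightarrow> 'a \<Rightarrow> 'a set" where
  "omega_limit S v x = (\<Inter>n::real. S closure_of {v t x | t. t > n})"

definition alpha_limit :: "'a topology \<Rightarrow> (real \<Rightarrow> 'a \<Rightarrow> 'a) \<Rightarrow> 'a \<Rightarrow> 'a set" where
  "alpha_limit S v x = (\<Inter>n::real. S closure_of {v t x | t. t < n})"

text \<open>Preservation of the time direction: along each orbit, \<open>h\<close> is covered by an increasing
  homeomorphism of the time axis (on a singular point every such \<open>\<tau>\<close> works).\<close>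

definition carries_orbits ::
    "'a topology \<Rightarrow> (real \<Rightarrow> 'a \<Rightarrow> 'a) \<Rightarrow> (real \<Rightarrow> 'b \<Rightarrow> 'b) \<Rightarrow> ('a \<Rightarrow> 'b) \<Rightarrow> bool" where
  "carries_orbits S v w h \<longleftrightarrow> (\<forall>x\<in>topspace S.
     h ` orbit v x = orbit w (h x) \<and>
     (\<exists>\<tau>::real \<Rightarrow> real. strict_mono \<tau> \<and> continuous_on UNIV \<tau> \<and> surj \<tau> \<and>
        (\<forall>t. h (v t x) = w (\<tau> t) (h x))))"

section \<open>Differentiable surfaces\<close>

text \<open>On a relatively open subset of the half plane, being \<open>C\<^sup>1\<close> up to the boundary
  means that the (then unique) derivative within the set varies continuously.\<close>

definition C1_on :: "complex set \<Rightarrow> (complex \<Rightarrow> complex) \<Rightarrow> bool" where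
  "C1_on W f \<longleftrightarrow> (\<exists>f'. (\<forall>z\<in>W. (f has_derivative f' z) (at z within W)) \<and>
     (\<forall>u. continuous_on W (\<lambda>z. f' z u)))"

definition transition :: "'a chart \<Rightarrow> 'a chart \<Rightarrow> complex \<Rightarrow> complex" where
  "transition c d = snd d \<circ> inv_into (fst c) (snd c)"

definition C1_atlas :: "'a topology \<Rightarrow> 'a chart set \<Rightarrow> bool" where
  "C1_atlas T A \<longleftrightarrow>
     (\<forall>c\<in>A. surface_chart T c) \<and> (\<Union>c\<in>A. fst c) = topspace T \<and>
     (\<forall>c\<in>A. \<forall>d\<in>A. C1_on (snd c ` (fst c \<inter> fst d)) (transition c d))"

text \<open>A tangent vector at a point is represented by its coordinates in all charts around
  the point, related by the derivatives of the transition maps. So a vector field is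
  a family \<open>X c p\<close>, only relevant for \<open>p \<in> fst c\<close>. It is only required to be continuous.\<close>

definition vector_field :: "'a topology \<Rightarrow> 'a chart set \<Rightarrow> ('a chart \<Rightarrow> 'a \<Rightarrow> complex) \<Rightarrow> bool" where
  "vector_field T A X \<longleftrightarrow>
     (\<forall>c\<in>A. continuous_map (subtopology T (fst c)) euclidean (X c)) \<and>
     (\<forall>c\<in>A. \<forall>d\<in>A. \<forall>p\<in>fst c \<inter> fst d. \<forall>L.
        (transition c d has_derivative L) (at (snd c p) within snd c ` (fst c \<inter> fst d)) \<longrightarrow>
        L (X c p) = X d p)"

definition generates ::
    "'a topology \<Rightarrow> 'a chart set \<Rightarrow> ('a chart \<Rightarrow> 'a \<Rightarrow> complex) \<Rightarrow> (real \<Rightarrow> 'a \<Rightarrow> 'a) \<Rightarrow> bool" where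
  "generates T A X w \<longleftrightarrow> flow T w \<and>
     (\<forall>c\<in>A. \<forall>p\<in>topspace T. \<forall>t. w t p \<in> fst c \<longrightarrow>
        ((\<lambda>s. snd c (w s p)) has_vector_derivative X c (w t p)) (at t))"

definition C1_path :: "'a topology \<Rightarrow> 'a chart set \<Rightarrow> (real \<Rightarrow> 'a) \<Rightarrow> bool" where
  "C1_path T A g \<longleftrightarrow> continuous_map euclideanreal T g \<and>
     (\<forall>c\<in>A. \<exists>g'. (\<forall>t\<in>g -` fst c. ((\<lambda>s. snd c (g s)) has_vector_derivative g' t) (at t)) \<and>
        continuous_on (g -` fst c) g')"

section \<open>Closed transversals\<close>

text \<open>Closed curves are parametrized by the unit circle.\<close>

definition simple_closed_curve :: "'a topology \<Rightarrow> (complex \<Rightarrow> 'a) \<Rightarrow> bool" where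
  "simple_closed_curve S C \<longleftrightarrow>
     continuous_map (top_of_set (sphere 0 1)) S C \<and> inj_on C (sphere 0 1)"

text \<open>The surface \<open>T\<close> may be taken over the same type as \<open>S\<close>, as the two are homeomorphic.
  The tangent plane of \<open>T\<close> at \<open>h p\<close>, read in the chart \<open>c\<close>, is the whole plane; the tangent
  spaces of the curve \<open>h \<circ> C\<close> and of the orbit of \<open>h p\<close> are there spanned by the velocity of
  the curve and by the vector field, respectively. Both are allowed to be zero a priori,
  which the direct sum condition then excludes at \<open>p\<close>.\<close>

definition transverse_at :: "'a topology \<Rightarrow> (real \<Rightarrow> 'a \<Rightarrow> 'a) \<Rightarrow> (complex \<Rightarrow> 'a) \<Rightarrow> 'a \<Rightarrow> bool" where
  "transverse_at S v C p \<longleftrightarrow>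
     (\<exists>(T :: 'a topology) A X w h.
        surface T \<and> C1_atlas T A \<and> vector_field T A X \<and> generates T A X w \<and>
        homeomorphic_map S T h \<and> carries_orbits S v w h \<and>
        C1_path T A (\<lambda>t. h (C (cis t))) \<and>
        (\<forall>c\<in>A. h p \<in> fst c \<longrightarrow> (\<forall>t. C (cis t) = p \<longrightarrow>
           (let TC = span {vector_derivative (\<lambda>s. snd c (h (C (cis s)))) (at t)};
                TO = span {X c (h p)}
            in TC \<inter> TO = {0} \<and> {a + b | a b. a \<in> TC \<and> b \<in> TO} = UNIV))))"

definition closed_transversal :: "'a topology \<Rightarrow> (real \<Rightarrow> 'a \<Rightarrow> 'a) \<Rightarrow> (complex \<Rightarrow> 'a) \<Rightarrow> bool" where
  "closed_transversal S v C \<longleftrightarrow>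
     simple_closed_curve S C \<and> (\<forall>p\<in>C ` sphere 0 1. transverse_at S v C p)"

definition quasi_Q_set :: "'a topology \<Rightarrow> (real \<Rightarrow> 'a \<Rightarrow> 'a) \<Rightarrow> 'a set \<Rightarrow> bool" where
  "quasi_Q_set S v Q \<longleftrightarrow>
     (\<exists>x\<in>topspace S. Q = omega_limit S v x \<or> Q = alpha_limit S v x) \<and>
     (\<exists>C. closed_transversal S v C \<and> essential S (C ` sphere 0 1) \<and>
          infinite (Q \<inter> C ` sphere 0 1))"

end

theory Submission
  imports Defs
begin

text \<open>Suppose that an \<open>\<omega>\<close>-limit set \<open>Q\<close> lies in an open disk \<open>D\<close> of the collapsed surface. By compactness
  the orbit eventually stays in \<open>D\<close>. An essential closed transversal \<open>C\<close> is not contained in \<open>D\<close>, so a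
  point of \<open>Q \<inter> C\<close> lies on an arc of \<open>C \<inter> D\<close> that tends to infinity in \<open>D \<cong> \<complex>\<close> at both ends.
  By the Jordan curve theorem such an arc separates \<open>D\<close>, and by transversality all orbits cross it in
  the same direction. Hence the orbit crosses it at most once, although it has to cross it near the
  point of \<open>Q\<close> at arbitrarily late times.
  The \<open>\<alpha>\<close>-limit sets are covered by reversing time. The only consequences of transversality needed
  are that \<open>C\<close> avoids the boundary and that \<open>(s, t) \<mapsto> v\<^sub>t(C(s))\<close> is locally injective, hence open by
  invariance of domain.\<close>

text \<open>Transversality is granted point by point, each time with its own surface
  \<open>T\<close>, homeomorphism \<open>h\<close> and time change, and the vector fields are merely
  continuous. So no common orientation along the curve is given, and no C1 flow box comes from the
  inverse function theorem. Injectivity of the flow map near one point is obtained instead from mean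
  value estimates in a single chart, and the common crossing direction from connectedness: the side
  reached by small positive times is locally constant along the arc.

  The second obstacle is the boundary. The disk lies in the collapsed surface, where distinct
  boundary points may share an image, so the planar coordinate determines a point of
  \<open>S\<close> only if that point is interior. This suffices because a transversal has no
  boundary points: there the curve and the orbit would both be tangent to the boundary. It also
  explains why the arc tends to infinity: its endpoints are interior points outside the disk, and
  such a point can be separated from every compact part of the disk by treating the whole boundary
  as one closed set.\<close>

section \<open>Separation of the plane by a transverse line\<close>

text \<open>The inversion about a point \<open>z0\<close> off the line turns the line into a Jordan curve through \<open>0\<close>.\<close>

lemma line_separates_plane:
  fixes \<gamma> :: "real \<Rightarrow> complex"
  assumes ab: "a < b" and cont: "continuous_on {a<..<b} \<gamma>" and inj: "inj_on \<gamma> {a<..<b}"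
    and lima: "filterlim \<gamma> at_infinity (at_right a)" and limb: "filterlim \<gamma> at_infinity (at_left b)"
    and z0: "z0 \<notin> \<gamma> ` {a<..<b}"
  obtains L R where "open L" "open R" "L \<inter> R = {}" "L \<union> R = - \<gamma> ` {a<..<b}"
    "\<gamma> ` {a<..<b} \<subseteq> closure L" "\<gamma> ` {a<..<b} \<subseteq> closure R"
proof -
  \<comment> \<open>The value 0 outside the open interval is the limit of the inverse at both ends,
    so \<open>G\<close> is the continuous extension and closes up at 0.\<close>
  define G where "G t = (if a < t \<and> t < b then inverse (\<gamma> t - z0) else 0)" for t
  define c where "c x = G (a + x * (b - a))" for x
  have ne: "\<gamma> t - z0 \<noteq> 0" if "a < t" "t < b" for t
    using z0 that by auto
  have Gne: "G t \<noteq> 0" if "a < t" "t < b" for t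
    using ne that by (simp add: G_def)
  have contG: "continuous_on {a..b} G"
  proof (rule continuous_on_IccI)
    have "filterlim (\<lambda>t. \<gamma> t + - z0) at_infinity (at_right a)"
      using lima by (intro tendsto_add_filterlim_at_infinity') auto
    then have "((\<lambda>t. inverse (\<gamma> t - z0)) \<longlongrightarrow> 0) (at_right a)"
      by (auto intro: filterlim_compose[OF tendsto_inverse_0])
    moreover have "\<forall>\<^sub>F t in at_right a. inverse (\<gamma> t - z0) = G t"
      unfolding eventually_at_right[OF ab] using ab by (auto simp: G_def intro!: exI[of _ b])
    ultimately have "(G \<longlongrightarrow> 0) (at_right a)"
      by (rule Lim_transform_eventually)
    then show "(G \<longlongrightarrow> G a) (at_right a)"
      by (simp add: G_def[of a])
    have "filterlim (\<lambda>t. \<gamma> t + - z0) at_infinity (at_left b)"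
      using limb by (intro tendsto_add_filterlim_at_infinity') auto
    then have "((\<lambda>t. inverse (\<gamma> t - z0)) \<longlongrightarrow> 0) (at_left b)"
      by (auto intro: filterlim_compose[OF tendsto_inverse_0])
    moreover have "\<forall>\<^sub>F t in at_left b. inverse (\<gamma> t - z0) = G t"
      unfolding eventually_at_left[OF ab] using ab by (auto simp: G_def intro!: exI[of _ a])
    ultimately have "(G \<longlongrightarrow> 0) (at_left b)"
      by (rule Lim_transform_eventually)
    then show "(G \<longlongrightarrow> G b) (at_left b)"
      by (simp add: G_def[of b])
    fix t assume t: "a < t" "t < b"
    have "continuous_on {a<..<b} (\<lambda>t. inverse (\<gamma> t - z0))"
      using ne by (intro continuous_intros cont) auto
    then have "continuous_on {a<..<b} G"
      by (rule continuous_on_eq) (auto simp: G_def)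
    then show "G \<midarrow>t\<rightarrow> G t"
      using t by (simp add: continuous_on_eq_continuous_at isCont_def)
  qed (fact ab)
  have inb: "a + x * (b - a) \<in> {a..b}" if "x \<in> {0..1}" for x
  proof -
    have "x * (b - a) \<le> 1 * (b - a)" "0 \<le> x * (b - a)"
      using that ab by (intro mult_right_mono mult_nonneg_nonneg; simp)+
    then show ?thesis using that by auto
  qed
  have "continuous_on {0..1} c"
    unfolding c_def
  proof (rule continuous_on_compose2[OF contG])
    show "continuous_on {0..1} (\<lambda>x. a + x * (b - a))" by (intro continuous_intros)
  qed (use inb in blast)
  moreover have ends: "c 0 = 0" "c 1 = 0"
    by (auto simp: c_def G_def)
  moreover have im: "c ` {0..1} = insert 0 ((\<lambda>t. inverse (\<gamma> t - z0)) ` {a<..<b})" (is "_ = ?J")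
  proof (intro equalityI subsetI)
    fix z assume "z \<in> c ` {0..1}"
    then show "z \<in> ?J" by (auto simp: c_def G_def)
  next
    fix z assume z: "z \<in> ?J"
    show "z \<in> c ` {0..1}"
    proof (cases "z = 0")
      case True
      then show ?thesis using ends by (intro image_eqI[of _ _ 0]) auto
    next
      case False
      then obtain t where t: "a < t" "t < b" "z = inverse (\<gamma> t - z0)" using z by auto
      then have "z = c ((t - a) / (b - a))" "(t - a) / (b - a) \<in> {0..1}"
        using ab by (auto simp: c_def G_def)
      then show ?thesis by blast
    qed
  qed
  moreover have "x = y \<or> x = 0 \<and> y = 1 \<or> x = 1 \<and> y = 0"
    if xy: "x \<in> {0..1}" "y \<in> {0..1}" "c x = c y" for x y
  proof -
    have in01: "a < a + u * (b - a) \<and> a + u * (b - a) < b" if "u \<in> {0..1}" "u \<noteq> 0" "u \<noteq> 1" for u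
    proof -
      have "u * (b - a) < 1 * (b - a)" "0 < u * (b - a)"
        using that ab by (intro mult_strict_right_mono mult_pos_pos; simp)+
      then show ?thesis by auto
    qed
    have endz: "c u = 0 \<longleftrightarrow> u = 0 \<or> u = 1" if "u \<in> {0..1}" for u
      using in01[OF that] ends Gne[of "a + u * (b - a)"] by (cases "u = 0 \<or> u = 1") (auto simp: c_def)
    show ?thesis
    proof (cases "c x = 0")
      case True
      then show ?thesis using endz xy by metis
    next
      case False
      then have "x \<noteq> 0" "x \<noteq> 1" "y \<noteq> 0" "y \<noteq> 1" using endz xy by metis+
      then have "\<gamma> (a + x * (b - a)) = \<gamma> (a + y * (b - a))"
        using xy in01[of x] in01[of y] by (simp add: c_def G_def)
      then have "a + x * (b - a) = a + y * (b - a)"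
        using \<open>x \<noteq> 0\<close> \<open>x \<noteq> 1\<close> \<open>y \<noteq> 0\<close> \<open>y \<noteq> 1\<close> xy in01[of x] in01[of y] by (intro inj_onD[OF inj]) auto
      then show ?thesis using ab by simp
    qed
  qed
  ultimately have "simple_path c" "pathfinish c = pathstart c"
    by (auto simp: simple_path_def loop_free_def path_def pathfinish_def pathstart_def)
  note J = Jordan_inside_outside[OF this]
  define K where "K = path_image c"
  have K: "K = insert 0 ((\<lambda>t. inverse (\<gamma> t - z0)) ` {a<..<b})"
    using im by (simp add: K_def path_image_def)
  define j where "j z = inverse (z - z0)" for z
  have contj: "continuous_on (-{z0}) j"
    unfolding j_def by (intro continuous_intros) auto
  have jinv: "j (z0 + inverse w) = w" for w
    by (simp add: j_def)
  have jK: "j z \<in> K \<longleftrightarrow> z \<in> \<gamma> ` {a<..<b}" if "z \<noteq> z0" for z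
    using that by (auto simp: K j_def image_iff)
  define L where "L = {z. z \<noteq> z0 \<and> j z \<in> inside K}"
  \<comment> \<open>The inversion sends \<open>z0\<close> to infinity, which belongs to the outside
    of the bounded curve, so \<open>z0\<close> is added by hand. Openness at \<open>z0\<close> is
    checked below with the ball of radius \<open>inverse B\<close>, where \<open>B\<close> bounds
    the curve.\<close>
  define R where "R = insert z0 {z. z \<noteq> z0 \<and> j z \<in> outside K}"
  have preim: "open {z. z \<noteq> z0 \<and> j z \<in> A}" if "open A" for A
  proof -
    have "{z. z \<noteq> z0 \<and> j z \<in> A} = j -` A \<inter> - {z0}" by auto
    then show ?thesis using continuous_open_preimage[OF contj _ that] by (simp add: Int_commute open_Compl)
  qed
  have clo: "z \<in> closure {z. z \<noteq> z0 \<and> j z \<in> A}" if z: "z \<in> \<gamma> ` {a<..<b}" and A: "frontier A = K" for z A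
  proof (rule closure_approachable[THEN iffD2], intro allI impI)
    fix e :: real assume e: "e > 0"
    have zn: "z \<noteq> z0" using z z0 by auto
    have "j z \<in> K" using z jK zn by simp
    then have cl: "j z \<in> closure A" using A by (auto simp: frontier_def)
    have j0: "j z \<noteq> 0" using zn by (simp add: j_def)
    have "isCont (\<lambda>w. z0 + inverse w) (j z)" using j0 by (intro continuous_intros) auto
    then obtain d where d: "d > 0" "\<And>w. dist w (j z) < d \<Longrightarrow> dist (z0 + inverse w) (z0 + inverse (j z)) < e"
      using e unfolding continuous_at_eps_delta by blast
    \<comment> \<open>The bound \<open>norm (j z)\<close> keeps the approximating point
      \<open>w\<close> away from 0, the one point where \<open>z0 + inverse w\<close> does not undo
      \<open>j\<close>.\<close>
    have "min d (norm (j z)) > 0" using d j0 by simp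
    then obtain w where w: "w \<in> A" "dist w (j z) < min d (norm (j z))"
      using cl closure_approachable by blast
    then have "w \<noteq> 0" by (auto simp: dist_norm)
    moreover have "z0 + inverse (j z) = z" by (simp add: j_def)
    ultimately show "\<exists>y\<in>{z. z \<noteq> z0 \<and> j z \<in> A}. dist y z < e"
      using w d(2)[of w] jinv[of w] by (intro bexI[of _ "z0 + inverse w"]) auto
  qed
  show thesis
  proof
    show "open L" unfolding L_def using J by (intro preim) (simp add: K_def)
    obtain B where B: "- cball 0 B \<subseteq> outside K" "B > 0"
    proof -
      have "bounded K" unfolding K_def using \<open>simple_path c\<close> bounded_simple_path_image by blast
      then obtain B where "K \<subseteq> cball 0 B" "B > 0" using bounded_subset_ballD[of K 0]
        by (meson ball_subset_cball order_trans)
      then show ?thesis using that outside_subset_convex[of "cball 0 B" K] by auto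
    qed
    have "open (outside K)" using J by (simp add: K_def)
    have nb: "z \<in> R" if "z \<in> ball z0 (inverse B)" for z
    proof (cases "z = z0")
      case False
      have "norm (z - z0) < inverse B" using that by (simp add: dist_norm norm_minus_commute)
      then have "inverse (inverse B) < inverse (norm (z - z0))"
        using False by (intro less_imp_inverse_less) auto
      then have "j z \<in> - cball 0 B" by (simp add: j_def norm_inverse)
      then show ?thesis using False B by (auto simp: R_def)
    qed (simp add: R_def)
    have "R = ball z0 (inverse B) \<union> {z. z \<noteq> z0 \<and> j z \<in> outside K}"
    proof -
      have "ball z0 (inverse B) \<subseteq> R" "z0 \<in> ball z0 (inverse B)" using nb B by auto
      then show ?thesis unfolding R_def by blast
    qed
    then show "open R" using preim[OF \<open>open (outside K)\<close>] by auto
    show "L \<inter> R = {}" using inside_Int_outside[of K] unfolding L_def R_def by blast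
    have "w \<in> inside K \<or> w \<in> outside K \<longleftrightarrow> w \<notin> K" for w
      using inside_Un_outside[of K] by blast
    then have "z \<in> L \<or> z \<in> R \<longleftrightarrow> z \<notin> \<gamma> ` {a<..<b}" for z
      unfolding L_def R_def using z0 jK[of z] by blast
    then show "L \<union> R = - \<gamma> ` {a<..<b}"
      by blast
    show "\<gamma> ` {a<..<b} \<subseteq> closure L"
      unfolding L_def using clo J by (auto simp: K_def)
    have "\<gamma> ` {a<..<b} \<subseteq> closure {z. z \<noteq> z0 \<and> j z \<in> outside K}"
      using clo J by (auto simp: K_def)
    also have "\<dots> \<subseteq> closure R" by (intro closure_mono) (auto simp: R_def)
    finally show "\<gamma> ` {a<..<b} \<subseteq> closure R" .
  qed
qed

text \<open>Right after \<open>t1\<close> the path is in \<open>R\<close>. At the first later time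
  \<open>u\<close> outside \<open>R\<close> it would have arrived from \<open>R\<close>. A crossing
  at \<open>u\<close> requires arrival from \<open>L\<close>; a value in the open set
  \<open>L\<close> also forces \<open>L\<close> shortly before; a value in the open set
  \<open>R\<close> contradicts the choice of \<open>u\<close>.\<close>

lemma one_way_crossing:
  fixes \<rho> :: "real \<Rightarrow> 'a::topological_space"
  assumes "open L" "open R" "L \<inter> R = {}" and cont: "continuous_on {t1..t2} \<rho>" and "t1 < t2"
    and Z1: "\<rho> t1 \<notin> L \<union> R" and Z2: "\<rho> t2 \<notin> L \<union> R"
    and cross: "\<And>t. t1 \<le> t \<Longrightarrow> t \<le> t2 \<Longrightarrow> \<rho> t \<notin> L \<union> R \<Longrightarrow>
      (\<forall>\<^sub>F u in at_right t. \<rho> u \<in> R) \<and> (\<forall>\<^sub>F u in at_left t. \<rho> u \<in> L)"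
  shows False
proof -
  define E where "E = {t. t1 < t \<and> t \<le> t2 \<and> \<rho> t \<notin> R}"
  define u where "u = Inf E"
  have t2E: "t2 \<in> E" using Z2 assms by (auto simp: E_def)
  have bdd: "bdd_below E" by (auto simp: E_def bdd_below_def intro!: exI[of _ t1])
  obtain b where b: "b > t1" "\<And>y. t1 < y \<Longrightarrow> y < b \<Longrightarrow> \<rho> y \<in> R"
    using cross[of t1] Z1 \<open>t1 < t2\<close> by (auto simp: eventually_at_right_field)
  have "b \<le> u" unfolding u_def
    by (rule cInf_greatest) (use t2E b in \<open>auto simp: E_def not_less[symmetric]\<close>)
  then have u1: "t1 < u" using b by simp
  have u2: "u \<le> t2" unfolding u_def by (rule cInf_lower[OF t2E bdd])
  have left: "\<rho> y \<in> R" if "t1 < y" "y < u" for y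
    using that u2 cInf_lower[OF _ bdd, of y] by (auto simp: u_def E_def not_less[symmetric])
  have leftev: "\<forall>\<^sub>F y in at_left u. \<rho> y \<in> R"
    unfolding eventually_at_left_field using left u1 by (auto intro!: exI[of _ t1])
  have notL: "\<not> (\<forall>\<^sub>F y in at_left u. \<rho> y \<in> L)"
  proof
    assume "\<forall>\<^sub>F y in at_left u. \<rho> y \<in> L"
    then have "\<forall>\<^sub>F y in at_left u. False"
      using leftev by eventually_elim (use \<open>L \<inter> R = {}\<close> in auto)
    then show False by simp
  qed
  have tend: "(\<rho> \<longlongrightarrow> \<rho> u) (at u within {t1..t2})"
    using cont u1 u2 by (auto simp: continuous_on_def)
  consider "\<rho> u \<notin> L \<union> R" | "\<rho> u \<in> L" | "\<rho> u \<in> R" by auto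
  then show False
  proof cases
    case 1
    then show False using cross[of u] u1 u2 notL by auto
  next
    case 2
    have "at_left u = at u within {t1..u}"
      using u1 by (simp add: at_within_Icc_at_left)
    then have "at_left u \<le> at u within {t1..t2}"
      using u2 by (simp add: at_le)
    then have "(\<rho> \<longlongrightarrow> \<rho> u) (at_left u)" using tend tendsto_mono by blast
    then show False using topological_tendstoD[OF _ \<open>open L\<close> 2] notL by blast
  next
    case 3
    then have "u \<noteq> t2" using t2E by (auto simp: E_def)
    then have "u < t2" using u2 by simp
    have "at_right u = at u within {u..t2}"
      using \<open>u < t2\<close> by (simp add: at_within_Icc_at_right)
    then have "at_right u \<le> at u within {t1..t2}"
      using u1 by (simp add: at_le)
    then have "(\<rho> \<longlongrightarrow> \<rho> u) (at_right u)" using tend tendsto_mono by blast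
    then have "\<forall>\<^sub>F y in at_right u. \<rho> y \<in> R" using topological_tendstoD[OF _ \<open>open R\<close> 3] by blast
    then obtain d where d: "d > u" "\<And>y. u < y \<Longrightarrow> y < d \<Longrightarrow> \<rho> y \<in> R"
      by (auto simp: eventually_at_right_field)
    have "d \<le> u" unfolding u_def
    proof (rule cInf_greatest)
      fix y assume y: "y \<in> E"
      then have "u \<le> y" unfolding u_def by (intro cInf_lower bdd)
      moreover have "y \<noteq> u" using y 3 by (auto simp: E_def)
      ultimately show "d \<le> y" using d(2)[of y] y by (auto simp: E_def not_less[symmetric])
    qed (use t2E in auto)
    then show False using d by simp
  qed
qed

text \<open>The half boxes on either side of the line are connected and miss the line, so each lies
  in \<open>L\<close> or in \<open>R\<close>. Their union with the line contains a neighbourhood of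
  \<open>\<gamma> s\<close>, to which both \<open>L\<close> and \<open>R\<close> accumulate, so the
  two halves lie on different sides. Which half lies where is locally constant in \<open>s\<close>,
  hence constant on the interval.\<close>

lemma flow_sides:
  fixes \<gamma> :: "real \<Rightarrow> complex" and \<Psi> :: "real \<times> real \<Rightarrow> complex"
  assumes ab: "a < b" and cont: "continuous_on {a<..<b} \<gamma>" and inj: "inj_on \<gamma> {a<..<b}"
    and lima: "filterlim \<gamma> at_infinity (at_right a)" and limb: "filterlim \<gamma> at_infinity (at_left b)"
    and init: "\<And>s. s \<in> {a<..<b} \<Longrightarrow> \<Psi> (s, 0) = \<gamma> s"
    and box: "\<And>s. s \<in> {a<..<b} \<Longrightarrow> \<exists>\<delta>>0. continuous_on ({s-\<delta><..<s+\<delta>} \<times> {-\<delta><..<\<delta>}) \<Psi> \<and>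
      inj_on \<Psi> ({s-\<delta><..<s+\<delta>} \<times> {-\<delta><..<\<delta>})"
  obtains L R where "open L" "open R" "L \<inter> R = {}" "L \<union> R = - \<gamma> ` {a<..<b}"
    "\<And>s. s \<in> {a<..<b} \<Longrightarrow>
      (\<forall>\<^sub>F \<tau> in at_right 0. \<Psi> (s, \<tau>) \<in> R) \<and> (\<forall>\<^sub>F \<tau> in at_left 0. \<Psi> (s, \<tau>) \<in> L)"
proof -
  define I where "I = {a<..<b}"
  \<comment> \<open>The given boxes are injective, but a remote piece of the line might still run
    through them. The boxes are shrunk until they meet the whole line only at time 0.\<close>
  have box': "\<exists>\<delta>>0. {s-\<delta><..<s+\<delta>} \<subseteq> I \<and> continuous_on ({s-\<delta><..<s+\<delta>} \<times> {-\<delta><..<\<delta>}) \<Psi> \<and>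
      inj_on \<Psi> ({s-\<delta><..<s+\<delta>} \<times> {-\<delta><..<\<delta>}) \<and>
      (\<forall>u\<in>{s-\<delta><..<s+\<delta>}. \<forall>\<tau>\<in>{-\<delta><..<\<delta>}. \<Psi> (u, \<tau>) \<in> \<gamma> ` I \<longrightarrow> \<tau> = 0)"
    if s: "s \<in> I" for s
  proof -
    obtain d0 where d0: "d0 > 0" "continuous_on ({s-d0<..<s+d0} \<times> {-d0<..<d0}) \<Psi>"
      "inj_on \<Psi> ({s-d0<..<s+d0} \<times> {-d0<..<d0})"
      using box s by (auto simp: I_def)
    define d where "d = min d0 (min (s - a) (b - s))"
    have d: "d > 0" "d \<le> d0" "{s-d<..<s+d} \<subseteq> I"
      using s d0 by (auto simp: d_def I_def)
    have sub: "{s-d<..<s+d} \<times> {-d<..<d} \<subseteq> {s-d0<..<s+d0} \<times> {-d0<..<d0}"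
      using d by auto
    have contd: "continuous_on ({s-d<..<s+d} \<times> {-d<..<d}) \<Psi>"
      and injd: "inj_on \<Psi> ({s-d<..<s+d} \<times> {-d<..<d})"
      using d0 sub continuous_on_subset inj_on_subset by blast+
    have "\<forall>\<^sub>F t in at_right a. norm (\<gamma> s) + 1 \<le> norm (\<gamma> t)"
      using lima[unfolded filterlim_at_infinity[OF order_refl]] s
      by (metis add_nonneg_pos norm_ge_zero zero_less_one)
    then obtain a' where a': "a < a'" "\<And>t. a < t \<Longrightarrow> t < a' \<Longrightarrow> norm (\<gamma> s) + 1 \<le> norm (\<gamma> t)"
      by (auto simp: eventually_at_right_field)
    have "\<forall>\<^sub>F t in at_left b. norm (\<gamma> s) + 1 \<le> norm (\<gamma> t)"
      using limb[unfolded filterlim_at_infinity[OF order_refl]] s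
      by (metis add_nonneg_pos norm_ge_zero zero_less_one)
    then obtain b' where b': "b' < b" "\<And>t. b' < t \<Longrightarrow> t < b \<Longrightarrow> norm (\<gamma> s) + 1 \<le> norm (\<gamma> t)"
      by (auto simp: eventually_at_left_field)
    \<comment> \<open>Beyond \<open>a'\<close> and \<open>b'\<close> the line has left the ball of
      radius 1 about \<open>\<gamma> s\<close>, because its norm there is at least
      \<open>norm (\<gamma> s) + 1\<close>. The remaining distant parameters form the compact set
      \<open>K\<close>, whose image misses \<open>\<gamma> s\<close> by injectivity.\<close>
    define K where "K = {a'..b'} - {s-d<..<s+d}"
    have "compact K" unfolding K_def by (intro compact_diff) auto
    moreover have "K \<subseteq> I" using a' b' by (auto simp: K_def I_def)
    ultimately have "compact (\<gamma> ` K)"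
      using cont I_def by (metis compact_continuous_image continuous_on_subset)
    then have "open (ball (\<gamma> s) 1 - \<gamma> ` K)"
      by (simp add: compact_imp_closed open_Diff)
    moreover have "\<gamma> s \<in> ball (\<gamma> s) 1 - \<gamma> ` K"
    proof -
      have "\<gamma> s \<notin> \<gamma> ` K"
      proof
        assume "\<gamma> s \<in> \<gamma> ` K"
        then obtain u where "u \<in> K" "\<gamma> s = \<gamma> u" by auto
        then have "s = u" using inj s \<open>K \<subseteq> I\<close> by (auto simp: I_def dest: inj_onD)
        then show False using \<open>u \<in> K\<close> d by (auto simp: K_def)
      qed
      then show ?thesis by simp
    qed
    moreover have "isCont \<Psi> (s, 0)"
      using contd d by (subst (asm) continuous_on_eq_continuous_at) (auto simp: open_Times)
    ultimately obtain r where "r > 0" "ball (\<gamma> s) r \<subseteq> ball (\<gamma> s) 1 - \<gamma> ` K"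
      and "isCont \<Psi> (s, 0)" by (meson open_contains_ball)
    moreover from this obtain e where e: "e > 0" "\<And>x. dist x (s, 0) < e \<Longrightarrow> dist (\<Psi> x) (\<Psi> (s, 0)) < r"
      unfolding continuous_at_eps_delta by blast
    moreover have "\<Psi> (s, 0) = \<gamma> s" using init s by (simp add: I_def)
    ultimately have e: "e > 0" "\<And>x. dist x (s, 0) < e \<Longrightarrow> \<Psi> x \<in> ball (\<gamma> s) 1 - \<gamma> ` K"
      by (auto simp: dist_commute mem_ball subset_iff)
    define \<delta> where "\<delta> = min d (e / 2)"
    have \<delta>: "\<delta> > 0" "\<delta> \<le> d" using d e by (auto simp: \<delta>_def)
    have sub': "{s-\<delta><..<s+\<delta>} \<times> {-\<delta><..<\<delta>} \<subseteq> {s-d<..<s+d} \<times> {-d<..<d}"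
      using \<delta> by auto
    have zero: "\<tau> = 0" if u: "u \<in> {s-\<delta><..<s+\<delta>}" "\<tau> \<in> {-\<delta><..<\<delta>}" "\<Psi> (u, \<tau>) \<in> \<gamma> ` I" for u \<tau>
    proof -
      have "dist (u, \<tau>) (s, 0) \<le> dist u s + dist \<tau> 0"
        unfolding dist_Pair_Pair by (rule sqrt_sum_squares_le_sum) auto
      also have "\<dots> < e" using u by (auto simp: dist_real_def \<delta>_def)
      finally have e': "\<Psi> (u, \<tau>) \<in> ball (\<gamma> s) 1 - \<gamma> ` K" by (rule e)
      obtain t where t: "t \<in> I" "\<Psi> (u, \<tau>) = \<gamma> t" using u by auto
      have "norm (\<gamma> t) < norm (\<gamma> s) + 1"
        using e' t norm_triangle_sub[of "\<gamma> t" "\<gamma> s"] by (auto simp: dist_norm norm_minus_commute)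
      then have "t \<in> {a'..b'}" using a'(2)[of t] b'(2)[of t] t by (auto simp: I_def not_less[symmetric])
      then have td: "t \<in> {s-d<..<s+d}" using e' t by (auto simp: K_def)
      have "\<Psi> (u, \<tau>) = \<Psi> (t, 0)" using t init by (auto simp: I_def)
      moreover have "(u, \<tau>) \<in> {s-d<..<s+d} \<times> {-d<..<d}" using u sub' by blast
      moreover have "(t, 0) \<in> {s-d<..<s+d} \<times> {-d<..<d}" using td d by auto
      ultimately have "(u, \<tau>) = (t, 0)" by (rule inj_onD[OF injd])
      then show ?thesis by simp
    qed
    show ?thesis
    proof (intro exI[of _ \<delta>] conjI ballI impI)
      show "{s-\<delta><..<s+\<delta>} \<subseteq> I" using \<delta> d by auto
      show "continuous_on ({s-\<delta><..<s+\<delta>} \<times> {-\<delta><..<\<delta>}) \<Psi>"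
        by (rule continuous_on_subset[OF contd sub'])
      show "inj_on \<Psi> ({s-\<delta><..<s+\<delta>} \<times> {-\<delta><..<\<delta>})"
        by (rule inj_on_subset[OF injd sub'])
    qed (use \<delta> zero in auto)
  qed
  obtain s0 where s0: "s0 \<in> I" using ab dense unfolding I_def by (metis greaterThanLessThan_iff)
  \<comment> \<open>A centre for the inversion is needed; a point slightly off the line in a
    shrunken box serves.\<close>
  obtain z0 where z0: "z0 \<notin> \<gamma> ` I"
  proof -
    obtain \<delta> where \<delta>: "\<delta> > 0" "\<And>u \<tau>. u \<in> {s0-\<delta><..<s0+\<delta>} \<Longrightarrow> \<tau> \<in> {-\<delta><..<\<delta>} \<Longrightarrow> \<Psi> (u, \<tau>) \<in> \<gamma> ` I \<Longrightarrow> \<tau> = 0"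
      using box'[OF s0] by blast
    have "\<Psi> (s0, \<delta> / 2) \<notin> \<gamma> ` I" using \<delta>(2)[of s0 "\<delta> / 2"] \<delta>(1) by auto
    then show thesis by (rule that)
  qed
  obtain L R where LR: "open L" "open R" "L \<inter> R = {}" "L \<union> R = - \<gamma> ` I"
    "\<gamma> ` I \<subseteq> closure L" "\<gamma> ` I \<subseteq> closure R"
    using line_separates_plane[OF ab cont inj lima limb] z0 unfolding I_def by metis
  \<comment> \<open>The quantifier over nearby \<open>u\<close> makes this an open condition on
    \<open>s\<close>, as the connectedness argument requires.\<close>
  define good where "good A B s \<longleftrightarrow> (\<exists>\<delta>>0. \<forall>u\<in>{s-\<delta><..<s+\<delta>}. \<forall>\<tau>\<in>{0<..<\<delta>}. \<Psi> (u, \<tau>) \<in> A \<and> \<Psi> (u, -\<tau>) \<in> B)"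
    for A B s
  have dich: "good R L s \<or> good L R s" if s: "s \<in> I" for s
  proof -
    obtain \<delta> where \<delta>: "\<delta> > 0" "{s-\<delta><..<s+\<delta>} \<subseteq> I" "continuous_on ({s-\<delta><..<s+\<delta>} \<times> {-\<delta><..<\<delta>}) \<Psi>"
      "inj_on \<Psi> ({s-\<delta><..<s+\<delta>} \<times> {-\<delta><..<\<delta>})"
      "\<And>u \<tau>. u \<in> {s-\<delta><..<s+\<delta>} \<Longrightarrow> \<tau> \<in> {-\<delta><..<\<delta>} \<Longrightarrow> \<Psi> (u, \<tau>) \<in> \<gamma> ` I \<Longrightarrow> \<tau> = 0"
      using box'[OF s] by blast
    define P where "P = \<Psi> ` ({s-\<delta><..<s+\<delta>} \<times> {0<..<\<delta>})"
    define N where "N = \<Psi> ` ({s-\<delta><..<s+\<delta>} \<times> {-\<delta><..<0})"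
    have conn: "connected P" "connected N" unfolding P_def N_def using \<delta>(1)
      by (intro connected_continuous_image continuous_on_subset[OF \<delta>(3)] connected_Times; auto)+
    have off: "\<Psi> (u, \<tau>) \<in> L \<union> R" if "u \<in> {s-\<delta><..<s+\<delta>}" "\<tau> \<in> {-\<delta><..<\<delta>}" "\<tau> \<noteq> 0" for u \<tau>
      using \<delta>(5)[OF that(1,2)] that(3) LR(4) by blast
    have sub: "P \<subseteq> L \<union> R" "N \<subseteq> L \<union> R"
    proof -
      show "P \<subseteq> L \<union> R" unfolding P_def
        by (rule image_subsetI, rule subst[OF prod.collapse], rule off) (use \<delta>(1) in auto)
      show "N \<subseteq> L \<union> R" unfolding N_def
        by (rule image_subsetI, rule subst[OF prod.collapse], rule off) (use \<delta>(1) in auto)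
    qed
    have side: "X \<subseteq> L \<or> X \<subseteq> R" if "connected X" "X \<subseteq> L \<union> R" for X
      using connectedD[OF that(1) LR(1,2)] that(2) LR(3) by blast
    have op: "open (\<Psi> ` ({s-\<delta><..<s+\<delta>} \<times> {-\<delta><..<\<delta>}))" (is "open ?W")
      using \<delta> by (intro invariance_of_domain_gen) (auto simp: open_Times)
    have "\<gamma> s = \<Psi> (s, 0)" using init s by (simp add: I_def)
    then have gW: "\<gamma> s \<in> ?W" using \<delta>(1) by auto
    have Wsub: "?W \<subseteq> P \<union> N \<union> \<gamma> ` I"
    proof clarify
      fix u \<tau> assume u: "u \<in> {s-\<delta><..<s+\<delta>}" "\<tau> \<in> {-\<delta><..<\<delta>}" "\<Psi> (u, \<tau>) \<notin> \<gamma> ` I" "\<Psi> (u, \<tau>) \<notin> N"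
      then have "\<tau> \<noteq> 0" using init[of u] \<delta>(2) by (auto simp: I_def)
      moreover have "\<not> \<tau> < 0" using u unfolding N_def by auto
      ultimately show "\<Psi> (u, \<tau>) \<in> P" using u unfolding P_def by auto
    qed
    \<comment> \<open>\<open>?W\<close> is an open neighbourhood of \<open>\<gamma> s\<close>, so it
      meets \<open>X\<close>; points of the line are not in \<open>X\<close>, hence the meeting
      point lies in one of the half boxes.\<close>
    have meet: "(P \<union> N) \<inter> X \<noteq> {}" if X: "X \<subseteq> L \<union> R" "\<gamma> ` I \<subseteq> closure X" for X
    proof -
      have "?W \<inter> X \<noteq> {}"
        using gW s X open_Int_closure_eq_empty[OF op, of X] by blast
      then show ?thesis using Wsub X LR(4) by blast
    qed
    have mL: "(P \<union> N) \<inter> L \<noteq> {}" and mR: "(P \<union> N) \<inter> R \<noteq> {}"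
      using meet[OF Un_upper1 LR(5)] meet[OF Un_upper2 LR(6)] by blast+
    have in_good: "good A B s" if "P \<subseteq> A" "N \<subseteq> B" for A B
      unfolding good_def using that \<delta>(1) by (intro exI[of _ \<delta>]) (auto simp: P_def N_def)
    show ?thesis
      using side[OF conn(1) sub(1)] side[OF conn(2) sub(2)] mL mR LR(3) in_good by blast
  qed
  have opengood: "open {s. good A B s}" for A B
    unfolding open_dist
  proof
    fix s assume "s \<in> {s. good A B s}"
    then obtain \<delta> where \<delta>: "\<delta> > 0" "\<And>u \<tau>. u \<in> {s-\<delta><..<s+\<delta>} \<Longrightarrow> \<tau>\<in>{0<..<\<delta>} \<Longrightarrow> \<Psi> (u, \<tau>) \<in> A \<and> \<Psi> (u, -\<tau>) \<in> B"
      by (auto simp: good_def)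
    have "good A B y" if "dist y s < \<delta> / 2" for y
      unfolding good_def
    proof (intro exI[of _ "\<delta> / 2"] conjI ballI)
      fix u \<tau> assume u: "u \<in> {y - \<delta> / 2<..<y + \<delta> / 2}" "\<tau> \<in> {0<..<\<delta> / 2}"
      have "\<bar>y - s\<bar> < \<delta> / 2" using that by (simp add: dist_real_def)
      then have "u \<in> {s-\<delta><..<s+\<delta>}" "\<tau>\<in>{0<..<\<delta>}" using u by (auto simp: abs_if split: if_splits)
      then show "\<Psi> (u, \<tau>) \<in> A" "\<Psi> (u, -\<tau>) \<in> B" using \<delta>(2) by blast+
    qed (use \<delta>(1) in simp)
    then show "\<exists>e>0. \<forall>y. dist y s < e \<longrightarrow> y \<in> {s. good A B s}" unfolding mem_Collect_eq using \<delta>(1) half_gt_zero by blast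
  qed
  have excl: "\<not> (good R L s \<and> good L R s)" for s
  proof
    assume "good R L s \<and> good L R s"
    then obtain d1 d2 where d: "d1 > 0" "d2 > 0" "\<forall>\<tau>\<in>{0<..<d1}. \<Psi> (s, \<tau>) \<in> R" "\<forall>\<tau>\<in>{0<..<d2}. \<Psi> (s, \<tau>) \<in> L"
      unfolding good_def by fastforce
    then have "\<Psi> (s, min d1 d2 / 2) \<in> L \<inter> R" by auto
    then show False using LR by auto
  qed
  have "connected I" by (simp add: I_def)
  moreover have "{s. good R L s} \<inter> {s. good L R s} \<inter> I = {}" using excl by blast
  moreover have "I \<subseteq> {s. good R L s} \<union> {s. good L R s}" using dich by blast
  ultimately have "{s. good R L s} \<inter> I = {} \<or> {s. good L R s} \<inter> I = {}"
    using connectedD[OF _ opengood opengood] by blast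
  then have uni: "(\<forall>s\<in>I. good R L s) \<or> (\<forall>s\<in>I. good L R s)"
    using dich by blast
  have goodev: "(\<forall>\<^sub>F \<tau> in at_right 0. \<Psi> (s, \<tau>) \<in> A) \<and> (\<forall>\<^sub>F \<tau> in at_left 0. \<Psi> (s, \<tau>) \<in> B)" if gd: "good A B s" for A B s
  proof -
    obtain \<delta> where \<delta>0: "\<delta> > 0" "\<forall>u\<in>{s-\<delta><..<s+\<delta>}. \<forall>\<tau>\<in>{0<..<\<delta>}. \<Psi> (u, \<tau>) \<in> A \<and> \<Psi> (u, -\<tau>) \<in> B"
      using gd unfolding good_def by blast
    have \<delta>: "\<delta> > 0" "\<And>\<tau>. \<tau>\<in>{0<..<\<delta>} \<Longrightarrow> \<Psi> (s, \<tau>) \<in> A \<and> \<Psi> (s, -\<tau>) \<in> B"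
      using \<delta>0(1) \<delta>0(2)[rule_format, of s] by auto
    have "\<Psi> (s, y) \<in> B" if "- \<delta> < y" "y < 0" for y using \<delta>(2)[of "- y"] that by auto
    then show ?thesis unfolding eventually_at_right_field eventually_at_left_field
      using \<delta> by (intro conjI exI[of _ \<delta>] exI[of _ "-\<delta>"]) auto
  qed
  show thesis
  proof (cases "\<forall>s\<in>I. good R L s")
    case True
    then have "\<And>s. s \<in> {a<..<b} \<Longrightarrow> good R L s" by (simp add: I_def)
    from that[OF LR(1-4)[unfolded I_def] goodev[OF this]] show ?thesis .
  next
    \<comment> \<open>All orbits cross from \<open>R\<close> to \<open>L\<close>, so the two sides
      exchange their names.\<close>
    case False
    then have "\<And>s. s \<in> {a<..<b} \<Longrightarrow> good L R s" using uni by (auto simp: I_def)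
    moreover have "R \<inter> L = {}" "R \<union> L = - \<gamma> ` {a<..<b}" using LR by (auto simp: I_def)
    ultimately show ?thesis using that[OF LR(2,1) _ _ goodev] by blast
  qed
qed

section \<open>Transversality\<close>

text \<open>A vector-valued mean value equation fails in general, but it holds after applying a
  linear functional, with an intermediate point depending on that functional. Closed segments allow
  the endpoints in either order.\<close>

lemma linear_image_mvt:
  fixes g :: "real \<Rightarrow> 'a::real_normed_vector" and f :: "'a \<Rightarrow> real"
  assumes f: "bounded_linear f"
    and g: "\<And>s. s \<in> closed_segment s1 s2 \<Longrightarrow> (g has_vector_derivative g' s) (at s)"
  obtains s where "s \<in> closed_segment s1 s2" "f (g s2 - g s1) = (s2 - s1) * f (g' s)"
proof -
  have *: "\<exists>s\<in>{a..b}. f (g b - g a) = (b - a) * f (g' s)"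
    if "a \<le> b" "{a..b} = closed_segment s1 s2" for a b
  proof -
    have "((\<lambda>s. f (g s)) has_derivative (\<lambda>h. h * f (g' s))) (at s within {a..b})" if "a \<le> s" "s \<le> b" for s
    proof -
      have "s \<in> {a..b}" using that by simp
      then have "s \<in> closed_segment s1 s2" unfolding \<open>{a..b} = _\<close> .
      from bounded_linear.has_vector_derivative[OF f g[OF this]]
      have "((\<lambda>s. f (g s)) has_vector_derivative f (g' s)) (at s within {a..b})"
        by (rule has_vector_derivative_at_within)
      then show ?thesis by (simp add: has_vector_derivative_def)
    qed
    from mvt_very_simple[OF \<open>a \<le> b\<close> this] show ?thesis
      by (simp add: linear_diff[OF bounded_linear.linear[OF f]])
  qed
  show thesis
  proof (cases "s1 \<le> s2")
    case True
    then show ?thesis using *[of s1 s2] that by (auto simp: closed_segment_eq_real_ivl)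
  next
    case False
    then obtain s where s: "s \<in> {s2..s1}" "f (g s1 - g s2) = (s1 - s2) * f (g' s)"
      using *[of s2 s1] by (auto simp: closed_segment_eq_real_ivl)
    have "f (g s2 - g s1) = - f (g s1 - g s2)"
      by (simp add: linear_diff[OF bounded_linear.linear[OF f]])
    then show ?thesis using that[of s] s False by (auto simp: closed_segment_eq_real_ivl algebra_simps)
  qed
qed

text \<open>The oriented area of the parallelogram spanned by two plane vectors; it vanishes exactly
  when they are linearly dependent over the reals.\<close>

definition det2 :: "complex \<Rightarrow> complex \<Rightarrow> real" where
  "det2 u z = Re u * Im z - Im u * Re z"

lemma bounded_linear_det2: "bounded_linear (det2 u)" "bounded_linear (\<lambda>z. det2 z u)"
  unfolding det2_def
  by (intro bounded_linear_intros bounded_linear_Re bounded_linear_Im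
      bounded_linear_sub[OF bounded_linear_compose[OF bounded_linear_mult_right bounded_linear_Im] bounded_linear_compose[OF bounded_linear_mult_right bounded_linear_Re]]
      bounded_linear_sub[OF bounded_linear_compose[OF bounded_linear_mult_left bounded_linear_Re] bounded_linear_compose[OF bounded_linear_mult_left bounded_linear_Im]])+

text \<open>Writing 1 and \<open>\<i>\<close> as combinations of the two vectors factors the
  identity matrix, so the coefficient determinant times \<open>det2 \<eta> \<xi>\<close> is
  1.\<close>

lemma det2_spanning:
  assumes "{a + b | a b. a \<in> span {\<eta>} \<and> b \<in> span {\<xi>}} = (UNIV :: complex set)"
  shows "det2 \<eta> \<xi> \<noteq> 0"
proof -
  obtain r1 q1 r2 q2 where "1 = r1 *\<^sub>R \<eta> + q1 *\<^sub>R \<xi>" and "\<i> = r2 *\<^sub>R \<eta> + q2 *\<^sub>R \<xi>"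
    using assms unfolding span_singleton set_eq_iff by blast
  then have e: "1 = r1 * Re \<eta> + q1 * Re \<xi>" "0 = r1 * Im \<eta> + q1 * Im \<xi>"
    "0 = r2 * Re \<eta> + q2 * Re \<xi>" "1 = r2 * Im \<eta> + q2 * Im \<xi>"
    by (simp_all add: complex_eq_iff)
  have "(r1 * q2 - q1 * r2) * det2 \<eta> \<xi> =
    (r1 * Re \<eta> + q1 * Re \<xi>) * (r2 * Im \<eta> + q2 * Im \<xi>) - (r1 * Im \<eta> + q1 * Im \<xi>) * (r2 * Re \<eta> + q2 * Re \<xi>)"
    by (simp add: det2_def algebra_simps)
  also have "\<dots> = 1" using e by simp
  finally show ?thesis by auto
qed

text \<open>Near a transverse intersection the chords of the curve and those of the orbits lie in disjoint
  double cones around the two tangent directions.\<close>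

lemma no_common_chord:
  fixes g w :: "real \<Rightarrow> complex"
  assumes g: "\<And>s. s \<in> closed_segment s1 s2 \<Longrightarrow> (g has_vector_derivative g' s) (at s)"
    and w: "\<And>s. s \<in> closed_segment u1 u2 \<Longrightarrow> (w has_vector_derivative w' s) (at s)"
    and gb: "\<And>s. s \<in> closed_segment s1 s2 \<Longrightarrow> D < \<bar>det2 (g' s) \<xi>\<bar> \<and> 2 * \<bar>det2 \<eta> (g' s)\<bar> < D"
    and wb: "\<And>s. s \<in> closed_segment u1 u2 \<Longrightarrow> D < \<bar>det2 \<eta> (w' s)\<bar> \<and> 2 * \<bar>det2 (w' s) \<xi>\<bar> < D"
    and eq: "g s2 - g s1 = w u2 - w u1"
  shows "s1 = s2 \<and> u1 = u2"
proof -
  obtain a where a: "a \<in> closed_segment s1 s2" "det2 (g s2 - g s1) \<xi> = (s2 - s1) * det2 (g' a) \<xi>"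
    by (rule linear_image_mvt[OF bounded_linear_det2(2) g])
  obtain b where b: "b \<in> closed_segment s1 s2" "det2 \<eta> (g s2 - g s1) = (s2 - s1) * det2 \<eta> (g' b)"
    by (rule linear_image_mvt[OF bounded_linear_det2(1) g])
  obtain c where c: "c \<in> closed_segment u1 u2" "det2 (w u2 - w u1) \<xi> = (u2 - u1) * det2 (w' c) \<xi>"
    by (rule linear_image_mvt[OF bounded_linear_det2(2) w])
  obtain d where d: "d \<in> closed_segment u1 u2" "det2 \<eta> (w u2 - w u1) = (u2 - u1) * det2 \<eta> (w' d)"
    by (rule linear_image_mvt[OF bounded_linear_det2(1) w])
  have D: "0 < D" using gb[OF b(1)] by linarith
  \<comment> \<open>The functional \<open>det2 _ \<xi>\<close> is large on curve velocities and
    small on orbit velocities, while \<open>det2 \<eta> _\<close> behaves the other way round.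
    Applied to the common chord, each makes one parameter difference at most half of the other, so
    both vanish.\<close>
  have "\<bar>s2 - s1\<bar> * D \<le> \<bar>det2 (g s2 - g s1) \<xi>\<bar>"
    unfolding a abs_mult using gb[OF a(1)] by (intro mult_left_mono) auto
  also have "\<dots> = \<bar>u2 - u1\<bar> * \<bar>det2 (w' c) \<xi>\<bar>"
    unfolding eq c abs_mult ..
  also have "\<dots> \<le> \<bar>u2 - u1\<bar> * (D / 2)"
    using wb[OF c(1)] by (intro mult_left_mono) auto
  finally have 1: "\<bar>s2 - s1\<bar> \<le> \<bar>u2 - u1\<bar> / 2"
    using D by (simp add: field_simps)
  have "\<bar>u2 - u1\<bar> * D \<le> \<bar>det2 \<eta> (w u2 - w u1)\<bar>"
    unfolding d abs_mult using wb[OF d(1)] by (intro mult_left_mono) auto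
  also have "\<dots> = \<bar>s2 - s1\<bar> * \<bar>det2 \<eta> (g' b)\<bar>"
    unfolding eq[symmetric] b abs_mult ..
  also have "\<dots> \<le> \<bar>s2 - s1\<bar> * (D / 2)"
    using gb[OF b(1)] by (intro mult_left_mono) auto
  finally have 2: "\<bar>u2 - u1\<bar> \<le> \<bar>s2 - s1\<bar> / 2"
    using D by (simp add: field_simps)
  have "x \<le> 0 \<and> y \<le> 0" if "x \<le> y / 2" "y \<le> x / 2" for x y :: real
    using that by auto
  from this[OF 1 2] show ?thesis by simp
qed

section \<open>Transverse points are interior\<close>

text \<open>The chart takes values in the upper half plane, so the imaginary part of the coordinate
  has a local minimum at a time when it is 0.\<close>

lemma chart_boundary_tangent:
  assumes f: "continuous_map euclideanreal T f" and c: "surface_chart T c" and ft: "f t \<in> fst c"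
    and bd: "Im (snd c (f t)) = 0"
    and d: "((\<lambda>s. snd c (f s)) has_vector_derivative d) (at t)"
  shows "Im d = 0"
proof -
  have "openin T (fst c)" and "openin (top_of_set half_plane) (snd c ` fst c)"
    using c by (auto simp: surface_chart_def split: prod.splits)
  then have half: "snd c ` fst c \<subseteq> half_plane" using openin_imp_subset by blast
  have "open {s. f s \<in> fst c}"
    using openin_continuous_map_preimage[OF f \<open>openin T (fst c)\<close>] by simp
  then obtain e where e: "e > 0" "\<And>s. dist s t < e \<Longrightarrow> f s \<in> fst c"
    using ft unfolding open_dist by blast
  have "((\<lambda>s. Im (snd c (f s))) has_vector_derivative Im d) (at t)"
    using bounded_linear.has_vector_derivative[OF bounded_linear_Im d] .
  then have "((\<lambda>s. Im (snd c (f s))) has_real_derivative Im d) (at t)"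
    by (simp add: has_real_derivative_iff_has_vector_derivative)
  moreover have "\<forall>y. \<bar>t - y\<bar> < e \<longrightarrow> Im (snd c (f t)) \<le> Im (snd c (f y))"
    using e half bd by (fastforce simp: dist_real_def half_plane_def abs_minus_commute)
  ultimately show ?thesis by (rule DERIV_local_min[OF _ e(1)])
qed

lemma chart_preimage_open:
  assumes c: "surface_chart T c" and "open W"
  shows "openin T {y \<in> fst c. snd c y \<in> W}"
proof -
  have U: "openin T (fst c)" and hom: "homeomorphic_map (subtopology T (fst c)) (top_of_set (snd c ` fst c)) (snd c)"
    using c by (auto simp: surface_chart_def split: prod.splits)
  have "continuous_map (subtopology T (fst c)) euclidean (snd c)"
    using homeomorphic_imp_continuous_map[OF hom] continuous_map_in_subtopology by blast
  then have "openin (subtopology T (fst c)) {y \<in> topspace (subtopology T (fst c)). snd c y \<in> W}"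
    by (rule openin_continuous_map_preimage) (simp add: \<open>open W\<close>)
  moreover have "{y \<in> topspace (subtopology T (fst c)). snd c y \<in> W} = {y \<in> fst c. snd c y \<in> W}"
    using openin_subset[OF U] by auto
  ultimately show ?thesis
    using openin_trans_full[OF _ U] by simp
qed

text \<open>The chart is restricted to the part with positive imaginary part, where relatively open
  in the half plane means open in the plane, and is then pulled back along \<open>h\<close>. This is
  the chart that \<open>surface_boundary\<close> asks about.\<close>

lemma interior_point_of_chart:
  assumes h: "homeomorphic_map S T h" and c: "surface_chart T c" and p: "p \<in> topspace S"
    and hp: "h p \<in> fst c" and im: "Im (snd c (h p)) > 0"
  shows "p \<notin> surface_boundary S"
proof -
  define V' where "V' = {y \<in> fst c. snd c y \<in> {z. Im z > 0}}"
  define V where "V = {x \<in> topspace S. h x \<in> V'}"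
  have U: "openin T (fst c)" and half: "openin (top_of_set half_plane) (snd c ` fst c)"
    and hom: "homeomorphic_map (subtopology T (fst c)) (top_of_set (snd c ` fst c)) (snd c)"
    using c by (auto simp: surface_chart_def split: prod.splits)
  have op: "open {z. Im z > 0}" by (rule open_halfspace_Im_gt)
  have V': "openin T V'" unfolding V'_def by (rule chart_preimage_open[OF c op])
  have Vop: "openin S V" unfolding V_def
    by (rule openin_continuous_map_preimage[OF homeomorphic_imp_continuous_map[OF h] V'])
  have hV: "h ` V = V'"
    using homeomorphic_imp_surjective_map[OF h] openin_subset[OF V'] by (auto simp: V_def)
  have "h ` (topspace S \<inter> V) = topspace T \<inter> V'"
    using hV openin_subset[OF V'] by (auto simp: V_def)
  then have h1: "homeomorphic_map (subtopology S V) (subtopology T V') h"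
    by (rule homeomorphic_map_subtopologies[OF h])
  have "V' \<subseteq> fst c" by (auto simp: V'_def)
  moreover from this have "snd c ` (topspace (subtopology T (fst c)) \<inter> V') = topspace (top_of_set (snd c ` fst c)) \<inter> snd c ` V'"
    using openin_subset[OF V'] by auto
  then have "homeomorphic_map (subtopology (subtopology T (fst c)) V') (subtopology (top_of_set (snd c ` fst c)) (snd c ` V')) (snd c)"
    by (rule homeomorphic_map_subtopologies[OF hom])
  ultimately have h2: "homeomorphic_map (subtopology T V') (top_of_set (snd c ` V')) (snd c)"
    by (simp add: subtopology_subtopology Int_absorb1 image_mono)
  have im: "(snd c \<circ> h) ` V = snd c ` V'" using hV by (metis image_comp)
  have "homeomorphic_map (subtopology S V) (top_of_set ((snd c \<circ> h) ` V)) (snd c \<circ> h)"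
    unfolding im by (rule homeomorphic_map_compose[OF h1 h2])
  moreover have "open ((snd c \<circ> h) ` V)"
  proof -
    obtain O' where O': "open O'" "snd c ` fst c = half_plane \<inter> O'"
      using half by (auto simp: openin_open)
    have "snd c ` V' = snd c ` fst c \<inter> {z. Im z > 0}" by (auto simp: V'_def)
    also have "\<dots> = O' \<inter> {z. Im z > 0}" unfolding O' by (auto simp: half_plane_def)
    finally show ?thesis unfolding im using O'(1) op by (simp add: open_Int)
  qed
  moreover have "(snd c \<circ> h) ` V \<subseteq> half_plane"
    unfolding im by (auto simp: V'_def half_plane_def)
  ultimately have "surface_chart S (V, snd c \<circ> h)" "open (snd (V, snd c \<circ> h) ` fst (V, snd c \<circ> h))"
    using Vop by (auto simp: surface_chart_def openin_open intro: exI[of _ "(snd c \<circ> h) ` V"])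
  moreover have "p \<in> fst (V, snd c \<circ> h)"
    using p hp \<open>Im (snd c (h p)) > 0\<close> by (simp add: V_def V'_def)
  ultimately show ?thesis unfolding surface_boundary_def by blast
qed

text \<open>Fixes one chart at the point and turns the condition on spans into a nonzero
  determinant, an inequality that survives small perturbations of the two velocities.\<close>

lemma transverse_at_det2:
  fixes S :: "'a topology"
  assumes sc: "simple_closed_curve S C" and tr: "transverse_at S v C (C (cis t0))"
  obtains T :: "'a topology" and A X w h c g' where "C1_atlas T A" "generates T A X w"
    "homeomorphic_map S T h" "carries_orbits S v w h" "c \<in> A" "h (C (cis t0)) \<in> fst c"
    "surface_chart T c" "continuous_map (subtopology T (fst c)) euclidean (X c)"
    "continuous_map euclideanreal T (\<lambda>t. h (C (cis t)))"
    "\<And>t. h (C (cis t)) \<in> fst c \<Longrightarrow> ((\<lambda>s. snd c (h (C (cis s)))) has_vector_derivative g' t) (at t)"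
    "continuous_on ((\<lambda>t. h (C (cis t))) -` fst c) g'"
    "det2 (g' t0) (X c (h (C (cis t0)))) \<noteq> 0"
proof -
  obtain T :: "'a topology" and A X w h where T: "C1_atlas T A" "vector_field T A X" "generates T A X w"
    "homeomorphic_map S T h" "carries_orbits S v w h" "C1_path T A (\<lambda>t. h (C (cis t)))"
    and D: "\<forall>c\<in>A. h (C (cis t0)) \<in> fst c \<longrightarrow> (\<forall>t. C (cis t) = C (cis t0) \<longrightarrow>
      span {vector_derivative (\<lambda>s. snd c (h (C (cis s)))) (at t)} \<inter> span {X c (h (C (cis t0)))} = {0} \<and>
      {a + b | a b. a \<in> span {vector_derivative (\<lambda>s. snd c (h (C (cis s)))) (at t)} \<and>
        b \<in> span {X c (h (C (cis t0)))}} = UNIV)"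
    using tr unfolding transverse_at_def Let_def by - (elim exE conjE, rule that, assumption+)
  have span: "{a + b | a b. a \<in> span {vector_derivative (\<lambda>s. snd c (h (C (cis s)))) (at t0)} \<and>
        b \<in> span {X c (h (C (cis t0)))}} = UNIV" if "c \<in> A" "h (C (cis t0)) \<in> fst c" for c
    using D[rule_format, OF that refl] by (rule conjunct2)
  have "C (cis t0) \<in> topspace S"
    using sc by (auto simp: simple_closed_curve_def continuous_map_def)
  then have "h (C (cis t0)) \<in> topspace T"
    using homeomorphic_imp_surjective_map[OF T(4)] by blast
  then obtain c where c: "c \<in> A" "h (C (cis t0)) \<in> fst c" "surface_chart T c"
    using T(1) unfolding C1_atlas_def by blast
  obtain g' where g': "\<And>t. h (C (cis t)) \<in> fst c \<Longrightarrow> ((\<lambda>s. snd c (h (C (cis s)))) has_vector_derivative g' t) (at t)"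
    "continuous_on ((\<lambda>t. h (C (cis t))) -` fst c) g'" "continuous_map euclideanreal T (\<lambda>t. h (C (cis t)))"
    using T(6) c(1) unfolding C1_path_def by (metis vimageI)
  have "vector_derivative (\<lambda>s. snd c (h (C (cis s)))) (at t0) = g' t0"
    by (rule vector_derivative_at) (rule g'(1)[OF c(2)])
  then have "det2 (g' t0) (X c (h (C (cis t0)))) \<noteq> 0"
    using det2_spanning[OF span[OF c(1,2)]] by simp
  moreover have "continuous_map (subtopology T (fst c)) euclidean (X c)"
    using T(2) c(1) by (auto simp: vector_field_def)
  ultimately show thesis using that[OF T(1,3,4,5) c] g' by blast
qed

lemma flow_curve_continuous:
  assumes "flow S v" "x \<in> topspace S"
  shows "continuous_map euclideanreal S (\<lambda>t. v t x)"
proof -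
  have "continuous_map euclideanreal (prod_topology euclideanreal S) (\<lambda>t. (t, x))"
    using assms(2) by (simp add: continuous_map_pairedI)
  from continuous_map_compose[OF this] assms(1) show ?thesis
    by (fastforce simp: flow_def o_def)
qed

text \<open>At a boundary point the velocities of the curve and of the orbit would both be
  horizontal in the chart, so their determinant would be 0.\<close>

lemma transverse_at_interior:
  fixes S :: "'a topology"
  assumes sc: "simple_closed_curve S C" and tr: "transverse_at S v C (C (cis t0))"
  shows "C (cis t0) \<notin> surface_boundary S"
proof -
  define p where "p = C (cis t0)"
  have p: "p \<in> topspace S"
    using sc by (auto simp: simple_closed_curve_def continuous_map_def p_def)
  obtain T :: "'a topology" and A X w h c g' where T0: "C1_atlas T A" "generates T A X w"
    "homeomorphic_map S T h" "carries_orbits S v w h" "c \<in> A" "h (C (cis t0)) \<in> fst c"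
    "surface_chart T c" "continuous_map (subtopology T (fst c)) euclidean (X c)"
    "continuous_map euclideanreal T (\<lambda>t. h (C (cis t)))"
    "\<And>t. h (C (cis t)) \<in> fst c \<Longrightarrow> ((\<lambda>s. snd c (h (C (cis s)))) has_vector_derivative g' t) (at t)"
    "continuous_on ((\<lambda>t. h (C (cis t))) -` fst c) g'"
    "det2 (g' t0) (X c (h (C (cis t0)))) \<noteq> 0"
    by (rule transverse_at_det2[OF sc tr]) (rule that; assumption)
  note T = T0(2,3,5,6,7,9) T0(10)[OF T0(6)] T0(12)
  note T = T[folded p_def]
  have hp: "h p \<in> topspace T" using homeomorphic_imp_surjective_map[OF T(2)] p by blast
  have fl: "flow T w" and gen: "w t (h p) \<in> fst c \<Longrightarrow> ((\<lambda>s. snd c (w s (h p))) has_vector_derivative X c (w t (h p))) (at t)" for t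
    using T(1,3) hp unfolding generates_def by blast+
  have w0: "w 0 (h p) = h p" using fl hp by (simp add: flow_def)
  have "snd c (h p) \<in> half_plane"
    using T(4,5) openin_imp_subset by (fastforce simp: surface_chart_def)
  moreover have "Im (snd c (h p)) \<noteq> 0"
  proof
    assume 0: "Im (snd c (h p)) = 0"
    have "Im (g' t0) = 0"
      using chart_boundary_tangent[OF T(6,5)] T(4,7) 0 by (simp add: p_def)
    moreover have "Im (X c (h p)) = 0"
      using chart_boundary_tangent[OF flow_curve_continuous[OF fl hp] T(5), of 0] gen[of 0] T(4) 0 by (simp add: w0)
    ultimately show False using T(8) by (simp add: det2_def)
  qed
  ultimately have "Im (snd c (h p)) > 0" by (simp add: half_plane_def)
  from interior_point_of_chart[OF T(2,5) p T(4) this] show ?thesis by (simp add: p_def)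
qed

section \<open>Local injectivity of the flow map along the curve\<close>

lemma flow_on_curve_continuous:
  assumes "flow S v" and sc: "simple_closed_curve S C"
  shows "continuous_map euclidean S (\<lambda>(s, t). v t (C (cis s)))"
proof -
  have "continuous_map euclideanreal (top_of_set (sphere 0 1)) cis"
    by (auto simp: continuous_map_in_subtopology intro!: continuous_intros)
  then have "continuous_map euclideanreal S (C \<circ> cis)"
    using sc continuous_map_compose unfolding simple_closed_curve_def by blast
  then have "continuous_map euclidean S (\<lambda>z::real \<times> real. C (cis (fst z)))"
    using continuous_map_compose[of euclidean euclidean fst S "C \<circ> cis"] by (simp add: o_def continuous_on_fst)
  moreover have "continuous_map (euclidean :: (real \<times> real) topology) euclidean snd"
    by (simp add: continuous_on_snd)
  ultimately have "continuous_map euclidean (prod_topology euclideanreal S) (\<lambda>z::real \<times> real. (snd z, C (cis (fst z))))"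
    by (simp add: continuous_map_pairedI)
  from continuous_map_compose[OF this] assms(1) show ?thesis
    by (fastforce simp: flow_def o_def case_prod_unfold)
qed

text \<open>If two parameter pairs have the same image, the orbit of one curve point reaches the
  other after time \<open>t1 - t2\<close>. In the chart the curve and the orbit then share a chord,
  which \<open>no_common_chord\<close> forbids as long as both velocities stay near their values at
  the centre.\<close>

lemma transverse_at_locally_injective:
  fixes S :: "'a topology"
  assumes fl: "flow S v" and sc: "simple_closed_curve S C" and tr: "transverse_at S v C (C (cis t0))"
  shows "\<exists>\<delta>>0. inj_on (\<lambda>(s, t). v t (C (cis s))) ({t0-\<delta><..<t0+\<delta>} \<times> {-\<delta><..<\<delta>})"
proof -
  obtain T :: "'a topology" and A X w h c g' where T: "C1_atlas T A" "generates T A X w"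
    "homeomorphic_map S T h" "carries_orbits S v w h" "c \<in> A" "h (C (cis t0)) \<in> fst c"
    "surface_chart T c" "continuous_map (subtopology T (fst c)) euclidean (X c)"
    "continuous_map euclideanreal T (\<lambda>t. h (C (cis t)))"
    "\<And>t. h (C (cis t)) \<in> fst c \<Longrightarrow> ((\<lambda>s. snd c (h (C (cis s)))) has_vector_derivative g' t) (at t)"
    "continuous_on ((\<lambda>t. h (C (cis t))) -` fst c) g'"
    "det2 (g' t0) (X c (h (C (cis t0)))) \<noteq> 0"
    by (rule transverse_at_det2[OF sc tr]) (rule that; assumption)
  define \<eta> \<xi> where "\<eta> = g' t0" and "\<xi> = X c (h (C (cis t0)))"
  \<comment> \<open>Any number strictly between 0 and \<open>\<bar>det2 \<eta> \<xi>\<bar>\<close>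
    would do: since \<open>det2 \<eta> \<eta>\<close> and \<open>det2 \<xi> \<xi>\<close> are 0, the
    sets \<open>B1\<close> and \<open>B2\<close> below are then neighbourhoods of
    \<open>\<eta>\<close> and \<open>\<xi>\<close> on which the chord estimate applies.\<close>
  define D where "D = \<bar>det2 \<eta> \<xi>\<bar> / 2"
  have D: "D > 0" "D < \<bar>det2 \<eta> \<xi>\<bar>" using T(12) by (simp_all add: D_def \<eta>_def \<xi>_def)
  have self: "det2 \<eta> \<eta> = 0" "det2 \<xi> \<xi> = 0" by (simp_all add: det2_def)
  have cont2: "continuous_on UNIV (det2 u)" "continuous_on UNIV (\<lambda>z. det2 z u)" for u
    using bounded_linear_det2 by (simp_all add: linear_continuous_on)
  define B1 where "B1 = {z. D < \<bar>det2 z \<xi>\<bar> \<and> 2 * \<bar>det2 \<eta> z\<bar> < D}"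
  define B2 where "B2 = {z. D < \<bar>det2 \<eta> z\<bar> \<and> 2 * \<bar>det2 z \<xi>\<bar> < D}"
  have "open B1" "open B2" unfolding B1_def B2_def
    by (intro open_Collect_conj open_Collect_less continuous_intros cont2)+
  have "\<eta> \<in> B1" "\<xi> \<in> B2" using D self by (auto simp: B1_def B2_def)
  have x: "C (cis s) \<in> topspace S" for s
    using sc by (auto simp: simple_closed_curve_def continuous_map_def)
  have U: "openin T (fst c)" using T(7) by (auto simp: surface_chart_def split: prod.splits)
  define N where "N = {y \<in> topspace (subtopology T (fst c)). X c y \<in> B2}"
  have "openin (subtopology T (fst c)) N" unfolding N_def
    by (rule openin_continuous_map_preimage[OF T(8)]) (simp add: \<open>open B2\<close>)
  then have N: "openin T N" using openin_trans_full[OF _ U] by blast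
  have "h (C (cis t0)) \<in> N"
    using T(6) \<open>\<xi> \<in> B2\<close> openin_subset[OF U] by (auto simp: N_def \<xi>_def)
  define M where "M = (\<lambda>t. h (C (cis t))) -` fst c"
  have "open M" using openin_continuous_map_preimage[OF T(9) U] by (simp add: M_def vimage_def)
  then have "open (M \<inter> g' -` B1)"
    using continuous_open_preimage T(11) \<open>open B1\<close> unfolding M_def by blast
  moreover have "t0 \<in> M \<inter> g' -` B1" using T(6) \<open>\<eta> \<in> B1\<close> by (simp add: M_def \<eta>_def)
  ultimately obtain d1 where d1: "d1 > 0" "\<And>s. dist s t0 < d1 \<Longrightarrow> s \<in> M \<and> g' s \<in> B1"
    unfolding open_dist by blast
  have "continuous_map euclidean T (\<lambda>z. h ((\<lambda>(s, t). v t (C (cis s))) z))"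
    using continuous_map_compose[OF flow_on_curve_continuous[OF fl sc] homeomorphic_imp_continuous_map[OF T(3)]]
    by (simp add: o_def)
  from openin_continuous_map_preimage[OF this N]
  have "open {(s, t). h (v t (C (cis s))) \<in> N}" by (simp add: case_prod_unfold)
  moreover have "(t0, 0) \<in> {(s, t). h (v t (C (cis s))) \<in> N}"
    using fl x \<open>h (C (cis t0)) \<in> N\<close> by (simp add: flow_def)
  ultimately obtain d2 where d2: "d2 > 0" "\<And>z. dist z (t0, 0) < d2 \<Longrightarrow> z \<in> {(s, t). h (v t (C (cis s))) \<in> N}"
    unfolding open_dist by blast
  \<comment> \<open>The time difference of two points in the box can approach
    \<open>2 * \<delta>\<close> and the parameter offset \<open>\<delta>\<close>; together they stay
    below \<open>4 * \<delta>\<close>, hence below \<open>d2\<close>.\<close>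
  define \<delta> where "\<delta> = min d1 (d2 / 4)"
  have \<delta>: "\<delta> > 0" using d1 d2 by (simp add: \<delta>_def)
  have inN: "h (v t (C (cis s))) \<in> N" if "\<bar>s - t0\<bar> < \<delta>" "\<bar>t\<bar> < 2 * \<delta>" for s t
  proof -
    have "dist (s, t) (t0, 0) \<le> dist s t0 + dist t 0"
      unfolding dist_Pair_Pair by (rule sqrt_sum_squares_le_sum) auto
    also have "\<dots> < d2"
    proof -
      have "4 * \<delta> \<le> d2" by (simp add: \<delta>_def)
      then show ?thesis using that by (simp add: dist_real_def)
    qed
    finally show ?thesis using d2(2) by blast
  qed
  have unique: "s1 = s2 \<and> t1 = t2"
    if s: "\<bar>s1 - t0\<bar> < \<delta>" "\<bar>s2 - t0\<bar> < \<delta>" and t: "\<bar>t1\<bar> < \<delta>" "\<bar>t2\<bar> < \<delta>"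
      and eq: "v t1 (C (cis s1)) = v t2 (C (cis s2))" for s1 s2 t1 t2
  proof -
    define x1 x2 r where "x1 = C (cis s1)" and "x2 = C (cis s2)" and "r = t1 - t2"
    have x12: "x1 \<in> topspace S" "x2 \<in> topspace S" using x by (auto simp: x1_def x2_def)
    have v0: "v 0 x1 = x1" using fl x12 by (simp add: flow_def)
    have "v r x1 = v (- t2 + t1) x1" by (simp add: r_def)
    also have "\<dots> = v (- t2) (v t1 x1)" using fl x12 unfolding flow_def by blast
    also have "\<dots> = v (- t2) (v t2 x2)" using eq by (simp add: x1_def x2_def)
    also have "\<dots> = v (- t2 + t2) x2" using fl x12 unfolding flow_def by metis
    also have "\<dots> = x2" using fl x12 by (simp add: flow_def)
    finally have vr: "v r x1 = x2" .
    obtain \<tau> where \<tau>: "strict_mono \<tau>" "continuous_on UNIV \<tau>" "\<And>t. h (v t x1) = w (\<tau> t) (h x1)"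
      using T(4) x12(1) unfolding carries_orbits_def by blast
    have hx1: "h x1 \<in> topspace T" using homeomorphic_imp_surjective_map[OF T(3)] x12 by blast
    \<comment> \<open>\<open>\<tau> 0\<close> may differ from 0, so the chord runs from
      \<open>\<tau> 0\<close> to \<open>\<tau> r\<close>. By the intermediate value property every
      time in between comes from a time between 0 and \<open>r\<close>, so the orbit in
      \<open>T\<close> stays in \<open>N\<close> throughout.\<close>
    have "convex (\<tau> ` closed_segment 0 r)"
      using connected_continuous_image[OF continuous_on_subset[OF \<tau>(2)] connected_segment(1)]
      by (simp add: is_interval_connected_1[symmetric] is_interval_convex_1[symmetric])
    then have seg: "closed_segment (\<tau> 0) (\<tau> r) \<subseteq> \<tau> ` closed_segment 0 r"
      by (intro closed_segment_subset) auto
    have wseg: "w u (h x1) \<in> N" if u: "u \<in> closed_segment (\<tau> 0) (\<tau> r)" for u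
    proof -
      obtain z where z: "z \<in> closed_segment 0 r" "u = \<tau> z" using u seg by blast
      have "\<bar>z\<bar> \<le> \<bar>r\<bar>"
        using z(1) by (auto simp: closed_segment_eq_real_ivl split: if_splits)
      moreover have "\<bar>r\<bar> < 2 * \<delta>" using t by (simp add: r_def)
      ultimately have "h (v z (C (cis s1))) \<in> N" by (intro inN s(1)) simp
      then show ?thesis using \<tau>(3)[of z] z(2) by (simp add: x1_def)
    qed
    have gseg: "s \<in> M \<and> g' s \<in> B1" if "s \<in> closed_segment s1 s2" for s
    proof -
      have "\<bar>s - t0\<bar> < \<delta>" using that s by (auto simp: closed_segment_eq_real_ivl split: if_splits)
      then show ?thesis using d1(2) by (simp add: dist_real_def \<delta>_def)
    qed
    have "s1 = s2 \<and> \<tau> 0 = \<tau> r"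
    proof (rule no_common_chord[where D = D and \<eta> = \<eta> and \<xi> = \<xi>])
      show "((\<lambda>s. snd c (h (C (cis s)))) has_vector_derivative g' s) (at s)" if "s \<in> closed_segment s1 s2" for s
        using gseg[OF that] by (intro T(10)) (simp add: M_def)
      show "((\<lambda>u. snd c (w u (h x1))) has_vector_derivative X c (w u (h x1))) (at u)"
        if "u \<in> closed_segment (\<tau> 0) (\<tau> r)" for u
        using wseg[OF that] T(2,5) hx1 unfolding generates_def by (auto simp: N_def)
      show "D < \<bar>det2 (g' s) \<xi>\<bar> \<and> 2 * \<bar>det2 \<eta> (g' s)\<bar> < D" if "s \<in> closed_segment s1 s2" for s
        using gseg[OF that] by (simp add: B1_def)
      show "D < \<bar>det2 \<eta> (X c (w u (h x1)))\<bar> \<and> 2 * \<bar>det2 (X c (w u (h x1))) \<xi>\<bar> < D"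
        if "u \<in> closed_segment (\<tau> 0) (\<tau> r)" for u
        using wseg[OF that] by (simp add: N_def B2_def)
      show "snd c (h (C (cis s2))) - snd c (h (C (cis s1))) = snd c (w (\<tau> r) (h x1)) - snd c (w (\<tau> 0) (h x1))"
        using \<tau>(3)[of r] \<tau>(3)[of 0] vr v0 by (simp add: x1_def x2_def)
    qed
    then show ?thesis using strict_mono_eq[OF \<tau>(1)] by (simp add: r_def)
  qed
  have "inj_on (\<lambda>(s, t). v t (C (cis s))) ({t0-\<delta><..<t0+\<delta>} \<times> {-\<delta><..<\<delta>})"
  proof (rule inj_onI)
    fix z z' assume "z \<in> {t0-\<delta><..<t0+\<delta>} \<times> {-\<delta><..<\<delta>}" "z' \<in> {t0-\<delta><..<t0+\<delta>} \<times> {-\<delta><..<\<delta>}"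
      "(\<lambda>(s, t). v t (C (cis s))) z = (\<lambda>(s, t). v t (C (cis s))) z'"
    then show "z = z'"
      using unique[of "fst z" "fst z'" "snd z" "snd z'"] by (auto simp: abs_less_iff prod_eq_iff)
  qed
  then show ?thesis using \<delta> by blast
qed

section \<open>Recurrence in a disk\<close>

text \<open>Otherwise the closures of the late pieces of the orbit, with \<open>U\<close> removed,
  are nested nonempty closed sets. By compactness they share a point, which is a limit point outside
  \<open>U\<close>.\<close>

lemma orbit_eventually_in:
  assumes cpt: "compact_space S" and fl: "flow S v" and x: "x \<in> topspace S" and U: "openin S U"
    and sub: "omega_limit S v x \<subseteq> U"
  shows "\<exists>n. \<forall>t>n. v t x \<in> U"
proof (rule ccontr)
  assume no: "\<not> ?thesis"
  define F where "F m = (S closure_of {v t x | t. t > real m}) - U" for m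
  have "(\<Inter>m. F m) \<noteq> {}"
  proof (rule compact_space_imp_nest[OF cpt])
    show "closedin S (F m)" for m
      unfolding F_def using U by (intro closedin_diff closedin_closure_of)
    show "F m \<noteq> {}" for m
    proof -
      obtain t where t: "t > real m" "v t x \<notin> U" using no by blast
      have "v t x \<in> topspace S"
        using flow_curve_continuous[OF fl x] by (auto simp: continuous_map_def)
      then have "v t x \<in> S closure_of {v t x | t. t > real m}"
        using t unfolding in_closure_of by blast
      then show ?thesis using t by (auto simp: F_def)
    qed
    show "decseq F"
      unfolding decseq_def F_def by (intro allI impI Diff_mono closure_of_mono) force+
  qed
  then obtain y where y: "\<And>m. y \<in> F m" by blast
  have "y \<in> S closure_of {v t x | t. t > n}" for n
  proof -
    obtain m where m: "n \<le> real m" using real_arch_simple by blast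
    have "{v t x | t. t > real m} \<subseteq> {v t x | t. t > n}" using m by force
    from closure_of_mono[OF this] y[of m] show ?thesis by (auto simp: F_def)
  qed
  then have "y \<in> omega_limit S v x" by (auto simp: omega_limit_def)
  then show False using sub y[of 0] by (auto simp: F_def)
qed

section \<open>Parameters on the circle and components of open sets of reals\<close>

lemma cis_eq_imp_eq:
  assumes "cis s = cis s'" "\<bar>s - s'\<bar> < 2 * pi"
  shows "s = s'"
  using exp_complex_eqI[of "\<i> * of_real s" "\<i> * of_real s'"] assms by (simp add: cis_conv_exp)

lemma cis_surj_from:
  assumes "z \<in> sphere 0 1"
  obtains s where "a \<le> s" "s < a + 2 * pi" "z = cis s"
proof -
  define w where "w = z * cis (- a)"
  have "norm w = 1" using assms by (simp add: w_def norm_mult)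
  then have "w = cis (Arg2pi w)" using Arg2pi[of w] by (simp add: is_Arg_def cis_conv_exp)
  then have "z = cis (a + Arg2pi w)"
    by (metis w_def add.commute cis_mult cis_zero diff_self group_cancel.add1 mult.assoc mult.right_neutral ab_left_minus)
  then show thesis using that[of "a + Arg2pi w"] Arg2pi[of w] by simp
qed

text \<open>The ends are the points of the complement nearest to \<open>t\<close> on either side;
  they exist because the complement is closed. This cuts out the arc of the curve through a point of
  the disk.\<close>

lemma open_real_component:
  fixes J :: "real set"
  assumes J: "open J" and t: "t \<in> J" "l < t" "t < r" and l: "l \<notin> J" and r: "r \<notin> J"
  obtains a b where "l \<le> a" "a < t" "t < b" "b \<le> r" "a \<notin> J" "b \<notin> J" "{a<..<b} \<subseteq> J"
proof -
  define A where "A = {l..t} - J"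
  define B where "B = {t..r} - J"
  have "l \<in> A" "r \<in> B" using t l r by (auto simp: A_def B_def)
  then have AB: "closed A" "closed B" "A \<noteq> {}" "B \<noteq> {}" "bdd_above A" "bdd_below B"
    using J unfolding A_def B_def by (auto intro!: closed_Diff)
  have a: "Sup A \<in> A" using closed_contains_Sup AB by blast
  have b: "Inf B \<in> B" using closed_contains_Inf AB by blast
  have "y \<in> J" if y: "Sup A < y" "y < Inf B" for y
  proof (rule ccontr)
    assume "y \<notin> J"
    then have "y \<in> A \<or> y \<in> B" using a b y by (auto simp: A_def B_def)
    then show False using cSup_upper[OF _ AB(5)] cInf_lower[OF _ AB(6)] y by fastforce
  qed
  moreover have "Sup A \<noteq> t" "Inf B \<noteq> t" using a b t by (auto simp: A_def B_def)
  ultimately show thesis using a b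
    by (intro that[of "Sup A" "Inf B"]) (auto simp: A_def B_def)
qed

text \<open>The core contradiction, with the topology of the collapsed surface reduced to a planar
  coordinate \<open>k\<close> on \<open>U\<close>, an open set \<open>G\<close> of points that
  \<open>k\<close> identifies reliably, and growth of \<open>k\<close> near points of
  \<open>G\<close> outside \<open>U\<close>. Local injectivity stands in for transversality so that
  the same lemma serves the reversed flow.\<close>

lemma locally_injective_transversal_not_recurrent:
  fixes S :: "'a topology" and k :: "'a \<Rightarrow> complex"
  assumes fl: "flow S v" and sc: "simple_closed_curve S C"
    and U: "openin S U" and kcont: "continuous_map (subtopology S U) euclidean k"
    and G: "openin S G" and kinj: "\<And>y z. y \<in> U \<inter> G \<Longrightarrow> z \<in> U \<Longrightarrow> k y = k z \<Longrightarrow> y = z"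
    and kinf: "\<And>p r. p \<in> G - U \<Longrightarrow> \<exists>W. openin S W \<and> p \<in> W \<and> (\<forall>y\<in>W \<inter> U. r \<le> norm (k y))"
    and CG: "C ` sphere 0 1 \<subseteq> G"
    and linj: "\<And>t0. \<exists>\<delta>>0. inj_on (\<lambda>(s, t). v t (C (cis s))) ({t0-\<delta><..<t0+\<delta>} \<times> {-\<delta><..<\<delta>})"
    and leaves: "\<not> C ` sphere 0 1 \<subseteq> U"
    and x: "x \<in> topspace S" and stays: "\<And>t. t > n \<Longrightarrow> v t x \<in> U"
    and q: "q \<in> omega_limit S v x" "q \<in> C ` sphere 0 1" "q \<in> U"
  shows False
proof -
  define c where "c s = C (cis s)" for s
  define \<Phi> where "\<Phi> = (\<lambda>(s, t). v t (c s))"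
  have \<Phi>cont: "continuous_map euclidean S \<Phi>"
    unfolding \<Phi>_def c_def by (rule flow_on_curve_continuous[OF fl sc])
  have ctop: "c s \<in> topspace S" for s
    using sc by (auto simp: simple_closed_curve_def continuous_map_def c_def)
  have cG: "c s \<in> G" for s using CG by (auto simp: c_def)
  have \<Phi>0: "\<Phi> (s, 0) = c s" for s
    using fl ctop by (simp add: flow_def \<Phi>_def)
  have cpre: "open {s. c s \<in> W}" if "openin S W" for W
  proof -
    have "open {z. \<Phi> z \<in> W}" using openin_continuous_map_preimage[OF \<Phi>cont that] by simp
    moreover have "continuous_on UNIV (\<lambda>s::real. (s, 0::real))" by (intro continuous_intros)
    ultimately have "open ((\<lambda>s::real. (s, 0::real)) -` {z. \<Phi> z \<in> W})"
      by (rule open_vimage)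
    then show ?thesis by (simp add: \<Phi>0 vimage_def)
  qed
  \<comment> \<open>The circle is cut open at a point outside \<open>U\<close>, so both ends of the
    period interval from \<open>l\<close> to \<open>r\<close> lie outside \<open>U\<close> and the
    arc through \<open>q\<close> ends within one period.\<close>
  obtain z1 where z1: "z1 \<in> sphere 0 1" "C z1 \<notin> U" using leaves by blast
  then obtain l where l: "z1 = cis l" using cis_surj_from[of z1 0] by metis
  define r where "r = l + 2 * pi"
  have "cis r = cis l" by (simp add: r_def complex_eq_iff)
  then have lr: "c l \<notin> U" "c r \<notin> U" using l z1 by (auto simp: c_def)
  obtain z0 where z0: "z0 \<in> sphere 0 1" "q = C z0" using q by blast
  then obtain t0 where t0: "l \<le> t0" "t0 < r" "q = c t0"
    using cis_surj_from[of z0 l] unfolding r_def c_def by metis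
  have "t0 \<noteq> l" using t0 lr q by auto
  then have "l < t0" using t0 by simp
  obtain a b where ab0: "l \<le> a" "a < t0" "t0 < b" "b \<le> r"
      "a \<notin> {s. c s \<in> U}" "b \<notin> {s. c s \<in> U}" "{a<..<b} \<subseteq> {s. c s \<in> U}"
    by (rule open_real_component[OF cpre[OF U], of t0 l r]) (use t0 \<open>l < t0\<close> lr q in auto)
  have ab: "l \<le> a" "a < t0" "t0 < b" "b \<le> r" "c a \<notin> U" "c b \<notin> U"
      "\<And>s. a < s \<Longrightarrow> s < b \<Longrightarrow> c s \<in> U"
    using ab0 by auto
  define \<gamma> where "\<gamma> s = k (c s)" for s
  define \<Psi> where "\<Psi> z = k (\<Phi> z)" for z
  have \<Psi>cont: "continuous_on P \<Psi>" if P: "\<Phi> ` P \<subseteq> U" for P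
  proof -
    have "continuous_map (top_of_set P) (subtopology S U) \<Phi>"
      using P continuous_map_from_subtopology[OF \<Phi>cont] by (auto simp: continuous_map_in_subtopology)
    from continuous_map_compose[OF this kcont] show ?thesis
      by (simp add: o_def \<Psi>_def[abs_def])
  qed
  have \<gamma>0: "\<Psi> (s, 0) = \<gamma> s" for s by (simp add: \<Psi>_def \<gamma>_def \<Phi>0)
  have \<gamma>cont: "continuous_on {a<..<b} \<gamma>"
  proof -
    have "continuous_on ({a<..<b} \<times> {0}) \<Psi>" using ab by (intro \<Psi>cont) (auto simp: \<Phi>0)
    then have "continuous_on {a<..<b} (\<lambda>s. \<Psi> (s, 0))"
      by (rule continuous_on_compose2) (auto intro!: continuous_intros)
    then show ?thesis by (simp add: \<gamma>0)
  qed
  have \<gamma>inj: "inj_on \<gamma> {a<..<b}"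
  proof (rule inj_onI)
    fix s s' assume s: "s \<in> {a<..<b}" "s' \<in> {a<..<b}" "\<gamma> s = \<gamma> s'"
    then have "c s = c s'" using ab cG by (intro kinj) (auto simp: \<gamma>_def)
    moreover have "inj_on C (sphere 0 1)" using sc by (simp add: simple_closed_curve_def)
    ultimately have "cis s = cis s'" by (auto simp: c_def dest: inj_onD)
    \<comment> \<open>Both parameters lie strictly inside an interval of length at most
      \<open>2 * pi\<close>, so their distance is strictly below the period.\<close>
    then show "s = s'" using s ab by (intro cis_eq_imp_eq) (auto simp: r_def abs_less_iff)
  qed
  have near_end: "\<exists>e>0. \<forall>s. \<bar>s - p\<bar> < e \<longrightarrow> a < s \<longrightarrow> s < b \<longrightarrow> R \<le> norm (\<gamma> s)" if p: "c p \<notin> U" for p R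
  proof -
    obtain W where W: "openin S W" "c p \<in> W" "\<forall>y\<in>W \<inter> U. R \<le> norm (k y)"
      using kinf[of "c p" R] cG p by blast
    from cpre[OF W(1)] W(2) obtain e where "e > 0" "\<And>s. dist s p < e \<Longrightarrow> c s \<in> W"
      unfolding open_dist by blast
    then show ?thesis using W(3) ab(7) by (intro exI[of _ e]) (auto simp: dist_real_def \<gamma>_def)
  qed
  have lima: "filterlim \<gamma> at_infinity (at_right a)"
    unfolding filterlim_at_infinity[OF order_refl]
  proof (intro allI impI)
    fix R :: real
    obtain e where "e > 0" "\<forall>s. \<bar>s - a\<bar> < e \<longrightarrow> a < s \<longrightarrow> s < b \<longrightarrow> R \<le> norm (\<gamma> s)"
      using near_end[OF ab(5)] by blast
    then show "\<forall>\<^sub>F s in at_right a. R \<le> norm (\<gamma> s)"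
      unfolding eventually_at_right_field using ab by (intro exI[of _ "min b (a + e)"]) auto
  qed
  have limb: "filterlim \<gamma> at_infinity (at_left b)"
    unfolding filterlim_at_infinity[OF order_refl]
  proof (intro allI impI)
    fix R :: real
    obtain e where "e > 0" "\<forall>s. \<bar>s - b\<bar> < e \<longrightarrow> a < s \<longrightarrow> s < b \<longrightarrow> R \<le> norm (\<gamma> s)"
      using near_end[OF ab(6)] by blast
    then show "\<forall>\<^sub>F s in at_left b. R \<le> norm (\<gamma> s)"
      unfolding eventually_at_left_field using ab by (intro exI[of _ "max a (b - e)"]) auto
  qed
  have box: "\<exists>\<delta>>0. {s0-\<delta><..<s0+\<delta>} \<subseteq> {a<..<b} \<and>
      \<Phi> ` ({s0-\<delta><..<s0+\<delta>} \<times> {-\<delta><..<\<delta>}) \<subseteq> U \<inter> G \<and>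
      continuous_on ({s0-\<delta><..<s0+\<delta>} \<times> {-\<delta><..<\<delta>}) \<Psi> \<and>
      inj_on \<Psi> ({s0-\<delta><..<s0+\<delta>} \<times> {-\<delta><..<\<delta>})" if s0: "s0 \<in> {a<..<b}" for s0
  proof -
    obtain d1 where d1: "d1 > 0" "inj_on \<Phi> ({s0-d1<..<s0+d1} \<times> {-d1<..<d1})"
      using linj[of s0] unfolding \<Phi>_def c_def by blast
    have "open {z. \<Phi> z \<in> U \<inter> G}"
      using openin_continuous_map_preimage[OF \<Phi>cont openin_Int[OF U G]] by simp
    moreover have "(s0, 0) \<in> {z. \<Phi> z \<in> U \<inter> G}" using s0 ab cG by (auto simp: \<Phi>0)
    ultimately obtain d2 where d2: "d2 > 0" "\<And>z. dist z (s0, 0) < d2 \<Longrightarrow> z \<in> {z. \<Phi> z \<in> U \<inter> G}"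
      unfolding open_dist by blast
    define \<delta> where "\<delta> = min (min d1 (d2 / 2)) (min (s0 - a) (b - s0))"
    have \<delta>: "\<delta> > 0" "\<delta> \<le> d1" "\<delta> \<le> d2 / 2" "\<delta> \<le> s0 - a" "\<delta> \<le> b - s0"
    proof -
      show "\<delta> \<le> d2 / 2" unfolding \<delta>_def by (rule min.coboundedI1, rule min.coboundedI2, rule order_refl)
    qed (use d1 d2 s0 in \<open>auto simp: \<delta>_def\<close>)
    let ?B = "{s0-\<delta><..<s0+\<delta>} \<times> {-\<delta><..<\<delta>}"
    have img: "\<Phi> ` ?B \<subseteq> U \<inter> G"
    proof (rule image_subsetI)
      fix z assume z: "z \<in> ?B"
      obtain s t where st: "z = (s, t)" by (cases z)
      have "dist (s, t) (s0, 0) \<le> dist s s0 + dist t 0"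
        unfolding dist_Pair_Pair by (rule sqrt_sum_squares_le_sum) auto
      also have "\<dots> < d2" using z \<delta> by (auto simp: st dist_real_def abs_if)
      finally show "\<Phi> z \<in> U \<inter> G" using d2(2) st by blast
    qed
    have "inj_on \<Phi> ?B"
      by (rule inj_on_subset[OF d1(2)]) (use \<delta> in auto)
    moreover have "inj_on k (\<Phi> ` ?B)"
      using img by (intro inj_onI kinj) blast+
    ultimately have "inj_on \<Psi> ?B"
      using comp_inj_on[of \<Phi> ?B k] by (simp add: o_def \<Psi>_def[abs_def])
    moreover have "continuous_on ?B \<Psi>" using img by (intro \<Psi>cont) blast
    ultimately show ?thesis using img \<delta> by (intro exI[of _ \<delta>]) auto
  qed
  have injbox: "\<exists>\<delta>>0. continuous_on ({s-\<delta><..<s+\<delta>} \<times> {-\<delta><..<\<delta>}) \<Psi> \<and>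
      inj_on \<Psi> ({s-\<delta><..<s+\<delta>} \<times> {-\<delta><..<\<delta>})" if "s \<in> {a<..<b}" for s
    using box[OF that] by blast
  obtain L R where LR: "open L" "open R" "L \<inter> R = {}" "L \<union> R = - \<gamma> ` {a<..<b}"
    and sides: "\<And>s. s \<in> {a<..<b} \<Longrightarrow>
      (\<forall>\<^sub>F \<tau> in at_right 0. \<Psi> (s, \<tau>) \<in> R) \<and> (\<forall>\<^sub>F \<tau> in at_left 0. \<Psi> (s, \<tau>) \<in> L)"
    using flow_sides[OF less_trans[OF ab(2,3)] \<gamma>cont \<gamma>inj lima limb \<gamma>0 injbox] by blast
  define \<rho> where "\<rho> t = k (v t x)" for t
  have \<rho>cont: "continuous_on {n<..} \<rho>"
  proof -
    have "continuous_map (top_of_set {n<..}) (subtopology S U) (\<lambda>t. v t x)"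
      using stays continuous_map_from_subtopology[OF flow_curve_continuous[OF fl x]]
      by (auto simp: continuous_map_in_subtopology)
    from continuous_map_compose[OF this kcont] show ?thesis
      by (simp add: o_def \<rho>_def[abs_def])
  qed
  have add: "v (s + t) x = v s (v t x)" for s t
    using fl x by (simp add: flow_def)
  have cross: "(\<forall>\<^sub>F u in at_right t. \<rho> u \<in> R) \<and> (\<forall>\<^sub>F u in at_left t. \<rho> u \<in> L)"
    if t: "t > n" "\<rho> t \<notin> L \<union> R" for t
  proof -
    have "\<rho> t \<in> \<gamma> ` {a<..<b}" using t(2) LR(4) by blast
    then obtain s where s: "s \<in> {a<..<b}" "k (c s) = k (v t x)" by (auto simp: \<rho>_def \<gamma>_def)
    \<comment> \<open>Equal coordinates give equal points here because the curve point lies in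
      \<open>G\<close>; about the orbit point only membership in \<open>U\<close> is known.\<close>
    then have "c s = v t x" using ab cG stays t(1) by (intro kinj) auto
    then have sh: "\<Psi> (s, \<tau>) = \<rho> (\<tau> + t)" for \<tau>
      by (simp add: \<Psi>_def \<Phi>_def \<rho>_def add)
    obtain e1 where e1: "e1 > 0" "\<And>y. 0 < y \<Longrightarrow> y < e1 \<Longrightarrow> \<rho> (y + t) \<in> R"
      using sides[OF s(1)] unfolding sh eventually_at_right_field by blast
    obtain e2 where e2: "e2 < 0" "\<And>y. e2 < y \<Longrightarrow> y < 0 \<Longrightarrow> \<rho> (y + t) \<in> L"
      using sides[OF s(1)] unfolding sh eventually_at_left_field by blast
    have "\<rho> y \<in> R" if "t < y" "y < t + e1" for y using e1(2)[of "y - t"] that by simp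
    moreover have "\<rho> y \<in> L" if "t + e2 < y" "y < t" for y using e2(2)[of "y - t"] that by simp
    ultimately show ?thesis
      unfolding eventually_at_right_field eventually_at_left_field using e1(1) e2(1)
      by (intro conjI exI[of _ "t + e1"] exI[of _ "t + e2"]) auto
  qed
  have hit: "\<exists>t>m. \<rho> t \<notin> L \<union> R" if m: "m \<ge> n" for m
  proof -
    obtain \<delta> where \<delta>: "\<delta> > 0" "{t0-\<delta><..<t0+\<delta>} \<subseteq> {a<..<b}"
      "\<Phi> ` ({t0-\<delta><..<t0+\<delta>} \<times> {-\<delta><..<\<delta>}) \<subseteq> U \<inter> G"
      "continuous_on ({t0-\<delta><..<t0+\<delta>} \<times> {-\<delta><..<\<delta>}) \<Psi>"
      "inj_on \<Psi> ({t0-\<delta><..<t0+\<delta>} \<times> {-\<delta><..<\<delta>})"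
      using box[of t0] ab by auto
    define B where "B = {t0-\<delta><..<t0+\<delta>} \<times> {-\<delta><..<\<delta>}"
    \<comment> \<open>By invariance of domain the points of \<open>U\<close> with coordinate in this
      image form a neighbourhood of \<open>q\<close>. A late orbit point in it lies in the flow box,
      and flowing back by its box time \<open>\<tau>\<close> lands exactly on the arc.\<close>
    have "open (\<Psi> ` B)"
      using \<delta> unfolding B_def by (intro invariance_of_domain_gen) (auto simp: open_Times)
    then have "openin (subtopology S U) {y \<in> topspace (subtopology S U). k y \<in> \<Psi> ` B}"
      by (intro openin_continuous_map_preimage[OF kcont]) simp
    then have op: "openin S {y \<in> topspace (subtopology S U). k y \<in> \<Psi> ` B}"
      by (rule openin_trans_full[OF _ U])
    have "k q = \<Psi> (t0, 0)" using t0 by (simp add: \<Psi>_def \<Phi>0)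
    moreover have "(t0, 0) \<in> B" using \<delta>(1) by (simp add: B_def)
    ultimately have qin: "q \<in> {y \<in> topspace (subtopology S U). k y \<in> \<Psi> ` B}"
      using q(3) openin_subset[OF U] by auto
    \<comment> \<open>The margin \<open>\<delta>\<close> compensates for the later shift by
      \<open>- \<tau>\<close>, so that the hit still occurs after time \<open>m\<close>.\<close>
    have "q \<in> S closure_of {v t x | t. t > m + \<delta>}"
      using q(1) unfolding omega_limit_def by blast
    then have "\<forall>T. q \<in> T \<and> openin S T \<longrightarrow> (\<exists>y. y \<in> {v t x | t. t > m + \<delta>} \<and> y \<in> T)"
      unfolding in_closure_of by (rule conjunct2)
    from this[rule_format, OF conjI[OF qin op]]
    obtain t where t: "t > m + \<delta>" "v t x \<in> U" "k (v t x) \<in> \<Psi> ` B" by auto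
    then obtain s \<tau> where s: "(s, \<tau>) \<in> B" "k (v t x) = k (\<Phi> (s, \<tau>))"
      by (auto simp: \<Psi>_def)
    then have "\<Phi> (s, \<tau>) = v t x" using \<delta>(3) t(2) unfolding B_def by (intro kinj) auto
    then have "v (- \<tau> + t) x = v (- \<tau>) (v \<tau> (c s))" unfolding add \<Phi>_def by simp
    also have "\<dots> = v (- \<tau> + \<tau>) (c s)"
    proof -
      have "v (- \<tau> + \<tau>) (c s) = v (- \<tau>) (v \<tau> (c s))" using fl ctop[of s] unfolding flow_def by blast
      then show ?thesis by (rule sym)
    qed
    also have "\<dots> = c s" using fl ctop by (simp add: flow_def)
    finally have "v (- \<tau> + t) x = c s" .
    then have "\<rho> (- \<tau> + t) = \<gamma> s" by (simp add: \<rho>_def \<gamma>_def)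
    moreover have "s \<in> {a<..<b}" using s(1) \<delta>(2) unfolding B_def by blast
    ultimately have "\<rho> (- \<tau> + t) \<notin> L \<union> R" using LR(4) by blast
    moreover have "- \<tau> + t > m" using t(1) s(1) by (auto simp: B_def)
    ultimately show ?thesis by blast
  qed
  obtain t1 where t1: "t1 > n" "\<rho> t1 \<notin> L \<union> R" using hit[of n] by blast
  obtain t2 where t2: "t2 > t1" "\<rho> t2 \<notin> L \<union> R" using hit[of t1] t1 by force
  show False
  proof (rule one_way_crossing[OF LR(1-3) _ t2(1) t1(2) t2(2)])
    show "continuous_on {t1..t2} \<rho>"
      by (rule continuous_on_subset[OF \<rho>cont]) (use t1 in auto)
  qed (use cross t1 in auto)
qed

section \<open>The collapsed surface\<close>

lemma surface_boundary_subset: "surface_boundary S \<subseteq> topspace S"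
  by (auto simp: surface_boundary_def)

lemma openin_surface_interior: "openin S (topspace S - surface_boundary S)"
proof (subst openin_subopen, intro ballI)
  fix x assume "x \<in> topspace S - surface_boundary S"
  then obtain c where c: "surface_chart S c" "x \<in> fst c" "open (snd c ` fst c)"
    by (auto simp: surface_boundary_def)
  have "openin S (fst c)" using c(1) by (auto simp: surface_chart_def split: prod.splits)
  moreover have "fst c \<subseteq> topspace S - surface_boundary S"
    using c openin_subset[OF \<open>openin S (fst c)\<close>] unfolding surface_boundary_def by blast
  ultimately show "\<exists>T. openin S T \<and> x \<in> T \<and> T \<subseteq> topspace S - surface_boundary S"
    using c(2) by blast
qed

lemma collapse_interior: "x \<notin> surface_boundary S \<Longrightarrow> collapse S x = {x}"
  by (simp add: collapse_def)

lemma collapse_boundary: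
  assumes "x \<in> surface_boundary S"
  shows "x \<in> collapse S x" "collapse S x \<subseteq> surface_boundary S"
proof -
  have "x \<in> topspace (subtopology S (surface_boundary S))"
    using assms surface_boundary_subset[of S] by auto
  then show "x \<in> collapse S x" using assms by (simp add: collapse_def connected_component_of_refl)
  show "collapse S x \<subseteq> surface_boundary S"
    using assms connected_component_of_subset_topspace[of "subtopology S (surface_boundary S)" x]
    by (auto simp: collapse_def)
qed

lemma collapse_eq_interior:
  assumes "collapse S x = collapse S y" "x \<notin> surface_boundary S"
  shows "x = y"
proof (cases "y \<in> surface_boundary S")
  case True
  then show ?thesis using assms collapse_boundary(2)[OF True] by (auto simp: collapse_interior)
next
  case False
  then show ?thesis using assms by (simp add: collapse_interior)
qed

text \<open>A set containing all or none of the boundary is a union of classes of the collapse.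
  Working only with such sets avoids any question about how individual boundary components sit
  inside the boundary.\<close>

lemma openin_collapse_image:
  assumes op: "openin S W" and sat: "W \<inter> surface_boundary S = {} \<or> surface_boundary S \<subseteq> W"
  shows "openin (collapsed_surface S) (collapse S ` W)"
    and "\<And>x. x \<in> topspace S \<Longrightarrow> collapse S x \<in> collapse S ` W \<Longrightarrow> x \<in> W"
proof -
  show *: "x \<in> W" if x: "x \<in> topspace S" "collapse S x \<in> collapse S ` W" for x
  proof -
    obtain y where y: "y \<in> W" "collapse S x = collapse S y" using x by blast
    show ?thesis
    proof (cases "x \<in> surface_boundary S \<and> y \<in> surface_boundary S")
      case True
      then show ?thesis using sat y by blast
    next
      case False
      then have "x = y" using collapse_eq_interior y(2) by metis
      then show ?thesis using y by simp
    qed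
  qed
  have "{x \<in> topspace S. collapse S x \<in> collapse S ` W} = W"
    using * openin_subset[OF op] by blast
  then show "openin (collapsed_surface S) (collapse S ` W)"
    using op openin_subset[OF op] by (auto simp: openin_collapsed_surface)
qed

text \<open>If \<open>y\<close> is a boundary point, the whole boundary is compact and is separated
  from \<open>p\<close> at once; otherwise a neighbourhood of \<open>y\<close> is cut down to the
  interior. Either way the set around \<open>y\<close> is saturated, so its image is open.\<close>

lemma separate_interior_point:
  assumes H: "Hausdorff_space S" and cpt: "compact_space S"
    and p: "p \<in> topspace S - surface_boundary S" and y: "y \<in> topspace S" "y \<noteq> p"
  shows "\<exists>V W. openin (collapsed_surface S) V \<and> collapse S y \<in> V \<and> openin S W \<and> p \<in> W \<and>
    (\<forall>x\<in>W. collapse S x \<notin> V)"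
proof -
  have "\<exists>V W. openin S V \<and> y \<in> V \<and> openin S W \<and> p \<in> W \<and> V \<inter> W = {} \<and>
    (V \<inter> surface_boundary S = {} \<or> surface_boundary S \<subseteq> V)"
  proof (cases "y \<in> surface_boundary S")
    case True
    have "topspace S - (topspace S - surface_boundary S) = surface_boundary S"
      using surface_boundary_subset[of S] by blast
    then have "closedin S (surface_boundary S)"
      using openin_surface_interior[of S] surface_boundary_subset[of S] by (simp add: closedin_def)
    then have "compactin S (surface_boundary S)" using cpt closedin_compact_space by blast
    moreover have "compactin S {p}" using p by simp
    ultimately obtain V W where "openin S V" "openin S W" "surface_boundary S \<subseteq> V" "{p} \<subseteq> W" "disjnt V W"
      using H p unfolding Hausdorff_space_compact_sets by (metis Diff_iff disjnt_insert2 disjnt_empty2)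
    then show ?thesis using True by (intro exI[of _ V] exI[of _ W]) (auto simp: disjnt_def)
  next
    case False
    obtain V W where "openin S V" "openin S W" "y \<in> V" "p \<in> W" "disjnt V W"
      using H p y unfolding Hausdorff_space_def by blast
    then show ?thesis using False y openin_Int[OF _ openin_surface_interior[of S], of V]
      by (intro exI[of _ "V \<inter> (topspace S - surface_boundary S)"] exI[of _ W]) (auto simp: disjnt_def)
  qed
  then obtain V W where VW: "openin S V" "y \<in> V" "openin S W" "p \<in> W" "V \<inter> W = {}"
    "V \<inter> surface_boundary S = {} \<or> surface_boundary S \<subseteq> V" by blast
  show ?thesis
  proof (intro exI conjI ballI)
    show "openin (collapsed_surface S) (collapse S ` V)" by (rule openin_collapse_image[OF VW(1,6)])
    show "collapse S x \<notin> collapse S ` V" if "x \<in> W" for x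
      using openin_collapse_image(2)[OF VW(1,6), of x] that VW(5) openin_subset[OF VW(3)] by blast
  qed (use VW in auto)
qed

text \<open>The usual proof that compact sets in Hausdorff spaces are closed, carried out only at
  interior points, where separation is available.\<close>

lemma compact_avoids_interior_point:
  assumes H: "Hausdorff_space S" and cpt: "compact_space S"
    and p: "p \<in> topspace S - surface_boundary S" and K: "compactin (collapsed_surface S) K"
    and pK: "collapse S p \<notin> K"
  shows "\<exists>W. openin S W \<and> p \<in> W \<and> (\<forall>x\<in>W. collapse S x \<notin> K)"
proof -
  define \<V> where "\<V> = {V. openin (collapsed_surface S) V \<and> (\<exists>W. openin S W \<and> p \<in> W \<and> (\<forall>x\<in>W. collapse S x \<notin> V))}"
  have "K \<subseteq> \<Union>\<V>"
  proof
    fix Y assume Y: "Y \<in> K"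
    then have "Y \<in> collapse S ` topspace S"
      using compactin_subset_topspace[OF K] topspace_collapsed_surface by blast
    then obtain y where y: "y \<in> topspace S" "Y = collapse S y" by blast
    then have "y \<noteq> p" using Y pK by blast
    from separate_interior_point[OF H cpt p y(1) this] show "Y \<in> \<Union>\<V>"
      unfolding \<V>_def y(2) by blast
  qed
  then obtain \<F> where F: "finite \<F>" "\<F> \<subseteq> \<V>" "K \<subseteq> \<Union>\<F>"
    using K unfolding compactin_def \<V>_def by (metis (mono_tags, lifting) mem_Collect_eq)
  have "\<forall>V\<in>\<F>. \<exists>W. openin S W \<and> p \<in> W \<and> (\<forall>x\<in>W. collapse S x \<notin> V)"
    using F(2) unfolding \<V>_def by blast
  then obtain w where w: "\<And>V. V \<in> \<F> \<Longrightarrow> openin S (w V) \<and> p \<in> w V \<and> (\<forall>x\<in>w V. collapse S x \<notin> V)"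
    by metis
  \<comment> \<open>The factor \<open>topspace S\<close> covers the empty subcover, whose
    intersection would be the whole type.\<close>
  have "openin S (topspace S \<inter> \<Inter>(w ` \<F>))"
    using F(1) w by (cases "\<F> = {}") (auto intro!: openin_Int openin_Inter)
  then show ?thesis
    using p w F(3) by (intro exI[of _ "topspace S \<inter> \<Inter>(w ` \<F>)"]) blast
qed

section \<open>Planar coordinates on an open disk\<close>

lemma unit_ball_homeomorphic_plane:
  "top_of_set (ball (0::complex) 1) homeomorphic_space (euclidean :: complex topology)"
proof -
  obtain f g where "homeomorphism (ball (0::complex) 1) (UNIV :: complex set) f g"
    using homeomorphic_ball01_UNIV unfolding homeomorphic_def by blast
  then have "homeomorphic_maps (top_of_set (ball (0::complex) 1)) (euclidean :: complex topology) f g"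
    by (auto simp: homeomorphic_maps_def homeomorphism_def continuous_map_in_subtopology)
  then show ?thesis unfolding homeomorphic_space_def by blast
qed

lemma inessential_plane_chart:
  assumes "inessential S A"
  obtains D f g where "openin (collapsed_surface S) D" "collapse S ` A \<subseteq> D"
    "homeomorphic_maps (subtopology (collapsed_surface S) D) (euclidean :: complex topology) f g"
proof -
  obtain D where D: "openin (collapsed_surface S) D" "collapse S ` A \<subseteq> D"
    "subtopology (collapsed_surface S) D homeomorphic_space top_of_set (ball (0::complex) 1)"
    using assms by (auto simp: inessential_def)
  show thesis
    using that D(1,2) homeomorphic_space_trans[OF D(3) unit_ball_homeomorphic_plane]
    unfolding homeomorphic_space_def by blast
qed

section \<open>Limit sets meeting a transversal\<close>

text \<open>If the limit set were inessential, the disk around its image would supply the planar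
  coordinate \<open>k\<close>, obtained by collapsing and then mapping the disk to the plane; the
  limit set would trap the orbit in the preimage of the disk.\<close>

lemma omega_limit_meeting_transversal_essential:
  assumes H: "Hausdorff_space S" and cpt: "compact_space S" and fl: "flow S v"
    and sc: "simple_closed_curve S C"
    and interior: "C ` sphere 0 1 \<inter> surface_boundary S = {}"
    and linj: "\<And>t0. \<exists>\<delta>>0. inj_on (\<lambda>(s, t). v t (C (cis s))) ({t0-\<delta><..<t0+\<delta>} \<times> {-\<delta><..<\<delta>})"
    and ess: "essential S (C ` sphere 0 1)" and x: "x \<in> topspace S"
    and meet: "omega_limit S v x \<inter> C ` sphere 0 1 \<noteq> {}"
  shows "essential S (omega_limit S v x)"
  unfolding essential_def
proof
  assume "inessential S (omega_limit S v x)"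
  then obtain D f g where D: "openin (collapsed_surface S) D" "collapse S ` omega_limit S v x \<subseteq> D"
    and fg: "homeomorphic_maps (subtopology (collapsed_surface S) D) (euclidean :: complex topology) f g"
    by (rule inessential_plane_chart)
  define U where "U = {y \<in> topspace S. collapse S y \<in> D}"
  define G where "G = topspace S - surface_boundary S"
  define k where "k y = f (collapse S y)" for y
  have Dtop: "topspace (subtopology (collapsed_surface S) D) = D"
    using openin_subset[OF D(1)] by auto
  have gf: "g (f Y) = Y" if "Y \<in> D" for Y
    using fg that Dtop by (auto simp: homeomorphic_maps_def)
  have gD: "g z \<in> D" and fgz: "f (g z) = z" for z
    using fg Dtop by (auto simp: homeomorphic_maps_def continuous_map_def)
  have U: "openin S U" using D(1) by (simp add: U_def openin_collapsed_surface)
  have G: "openin S G" unfolding G_def by (rule openin_surface_interior)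
  have "continuous_map (subtopology S U) (subtopology (collapsed_surface S) D) (collapse S)"
    using quotient_imp_continuous_map[OF quotient_map_collapse[of S]]
    by (auto simp: continuous_map_in_subtopology U_def intro: continuous_map_from_subtopology)
  then have kcont: "continuous_map (subtopology S U) euclidean k"
    using continuous_map_compose fg unfolding homeomorphic_maps_def k_def[abs_def] by (fastforce simp: o_def)
  have kinj: "y = z" if "y \<in> U \<inter> G" "z \<in> U" "k y = k z" for y z
  proof -
    have "collapse S y = collapse S z" using that gf unfolding U_def k_def by (metis (mono_tags, lifting) Int_iff mem_Collect_eq)
    then show ?thesis using that(1) collapse_eq_interior unfolding G_def by fast
  qed
  \<comment> \<open>A closed planar disk of radius \<open>r\<close> corresponds to a compact set in
    the collapsed surface that misses the image of \<open>p\<close>. Near \<open>p\<close> the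
    collapse avoids this set, so coordinates there have norm above \<open>r\<close>.\<close>
  have kinf: "\<exists>W. openin S W \<and> p \<in> W \<and> (\<forall>y\<in>W \<inter> U. r \<le> norm (k y))" if p: "p \<in> G - U" for p r
  proof -
    have "continuous_map euclidean (subtopology (collapsed_surface S) D) g"
      using fg by (simp add: homeomorphic_maps_def)
    then have "compactin (subtopology (collapsed_surface S) D) (g ` cball 0 r)"
      by (rule image_compactin[rotated]) simp
    then have K: "compactin (collapsed_surface S) (g ` cball 0 r)"
      by (simp add: compactin_subtopology)
    have pint: "p \<in> topspace S - surface_boundary S" using p by (simp add: G_def)
    have "collapse S p \<notin> g ` cball 0 r" using p gD by (auto simp: U_def G_def)
    from compact_avoids_interior_point[OF H cpt pint K this] obtain W where W: "openin S W" "p \<in> W" "\<forall>y\<in>W. collapse S y \<notin> g ` cball 0 r"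
      by blast
    have "r \<le> norm (k y)" if y: "y \<in> W \<inter> U" for y
    proof (rule ccontr)
      assume "\<not> r \<le> norm (k y)"
      then have "f (collapse S y) \<in> cball 0 r" by (simp add: k_def)
      moreover have "g (f (collapse S y)) = collapse S y" using y by (intro gf) (simp add: U_def)
      ultimately show False using W(3) y by (metis IntD1 image_eqI)
    qed
    then show ?thesis using W by blast
  qed
  have ctop: "C ` sphere 0 1 \<subseteq> topspace S"
    using sc by (auto simp: simple_closed_curve_def continuous_map_def)
  then have CG: "C ` sphere 0 1 \<subseteq> G" using interior by (auto simp: G_def)
  \<comment> \<open>Otherwise \<open>D\<close> itself would be an open disk around the collapsed
    curve, against its being essential.\<close>
  have leaves: "\<not> C ` sphere 0 1 \<subseteq> U"
  proof
    assume "C ` sphere 0 1 \<subseteq> U"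
    then have "collapse S ` (C ` sphere 0 1) \<subseteq> D" by (auto simp: U_def)
    moreover have "subtopology (collapsed_surface S) D homeomorphic_space top_of_set (ball (0::complex) 1)"
      using fg unit_ball_homeomorphic_plane homeomorphic_space_def homeomorphic_space_sym
        homeomorphic_space_trans by blast
    ultimately show False using ess D(1) unfolding essential_def inessential_def by blast
  qed
  have limtop: "omega_limit S v x \<subseteq> topspace S"
    unfolding omega_limit_def using closure_of_subset_topspace by fast
  then have "omega_limit S v x \<subseteq> U" using D(2) by (auto simp: U_def)
  then obtain n where n: "\<And>t. t > n \<Longrightarrow> v t x \<in> U"
    using orbit_eventually_in[OF cpt fl x U] by blast
  obtain q where "q \<in> omega_limit S v x" "q \<in> C ` sphere 0 1" using meet by blast
  then show False
    using locally_injective_transversal_not_recurrent[OF fl sc U kcont G kinj kinf CG linj leaves x n]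
      \<open>omega_limit S v x \<subseteq> U\<close> by blast
qed

section \<open>Time reversal and the conclusion\<close>

lemma flow_reverse:
  assumes "flow S v"
  shows "flow S (\<lambda>t. v (- t))"
proof -
  have "continuous_map (prod_topology euclideanreal S) (prod_topology euclideanreal S) (\<lambda>(t, x). (- t, x))"
    unfolding case_prod_unfold
    by (intro continuous_map_pairedI continuous_map_snd) (auto intro!: continuous_map_minus continuous_map_fst)
  then have "continuous_map (prod_topology euclideanreal S) S ((\<lambda>(t, x). v t x) \<circ> (\<lambda>(t, x). (- t, x)))"
    using assms continuous_map_compose unfolding flow_def by blast
  then have "continuous_map (prod_topology euclideanreal S) S (\<lambda>(t, x). v (- t) x)"
    by (simp add: o_def case_prod_unfold)
  moreover have "v (- (s + t)) x = v (- s) (v (- t) x)" if "x \<in> topspace S" for s t x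
  proof -
    have "v (- s + - t) x = v (- s) (v (- t) x)" using assms that unfolding flow_def by blast
    then show ?thesis by simp
  qed
  ultimately show ?thesis using assms by (simp add: flow_def)
qed

lemma alpha_limit_reverse:
  fixes S :: "'a topology"
  shows "alpha_limit S v x = omega_limit S (\<lambda>t. v (- t)) x"
proof -
  have "{v t x | t. t < n} = {v (- t) x | t. t > - n}" for n
    by (metis (no_types, opaque_lifting) minus_less_iff minus_minus)
  then have "alpha_limit S v x = (\<Inter>n. S closure_of {v (- t) x | t. t > - n})"
    by (simp add: alpha_limit_def)
  also have "\<dots> = omega_limit S (\<lambda>t. v (- t)) x"
  proof -
    have "(\<Inter>n. F (- n)) = (\<Inter>n. F n)" for F :: "real \<Rightarrow> 'a set"
      by (metis (no_types) image_image surj_uminus)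
    then show ?thesis unfolding omega_limit_def .
  qed
  finally show ?thesis .
qed

theorem lemma3p26:
  fixes S :: "'a topology" and v :: "real \<Rightarrow> 'a \<Rightarrow> 'a" and Q :: "'a set"
  assumes "surface S" and "compact_space S"
    and "flow S v"
    and "quasi_Q_set S v Q"
  shows "essential S Q"
proof -
  have H: "Hausdorff_space S" using assms(1) by (simp add: surface_def)
  obtain x C where x: "x \<in> topspace S" "Q = omega_limit S v x \<or> Q = alpha_limit S v x"
    and C: "closed_transversal S v C" "essential S (C ` sphere 0 1)" "infinite (Q \<inter> C ` sphere 0 1)"
    using assms(4) by (auto simp: quasi_Q_set_def)
  have sc: "simple_closed_curve S C" and tr: "transverse_at S v C (C (cis t))" for t
    using C(1) by (auto simp: closed_transversal_def)
  have "C z \<notin> surface_boundary S" if "z \<in> sphere 0 1" for z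
    using cis_surj_from[OF that, of 0] transverse_at_interior[OF sc tr] by metis
  then have interior: "C ` sphere 0 1 \<inter> surface_boundary S = {}" by blast
  have meet: "Q \<inter> C ` sphere 0 1 \<noteq> {}" using C(3) by auto
  have linj: "\<exists>\<delta>>0. inj_on (\<lambda>(s, t). v t (C (cis s))) ({t0-\<delta><..<t0+\<delta>} \<times> {-\<delta><..<\<delta>})" for t0
    by (rule transverse_at_locally_injective[OF assms(3) sc tr])
  \<comment> \<open>The box is symmetric in time, so local injectivity passes to the reversed flow
    by reflection, without constructing transversality data for that flow.\<close>
  have linj': "\<exists>\<delta>>0. inj_on (\<lambda>(s, t). v (- t) (C (cis s))) ({t0-\<delta><..<t0+\<delta>} \<times> {-\<delta><..<\<delta>})" for t0
  proof -
    obtain \<delta> where \<delta>: "\<delta> > 0" "inj_on (\<lambda>(s, t). v t (C (cis s))) ({t0-\<delta><..<t0+\<delta>} \<times> {-\<delta><..<\<delta>})"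
      using linj by blast
    have "inj_on (\<lambda>(s, t). v (- t) (C (cis s))) ({t0-\<delta><..<t0+\<delta>} \<times> {-\<delta><..<\<delta>})"
    proof (rule inj_onI, clarify)
      fix s t s' t' :: real
      assume "s \<in> {t0-\<delta><..<t0+\<delta>}" "t \<in> {-\<delta><..<\<delta>}" "s' \<in> {t0-\<delta><..<t0+\<delta>}" "t' \<in> {-\<delta><..<\<delta>}"
        "v (- t) (C (cis s)) = v (- t') (C (cis s'))"
      then show "s = s' \<and> t = t'"
        using inj_onD[OF \<delta>(2), of "(s, - t)" "(s', - t')"] by auto
    qed
    then show ?thesis using \<delta>(1) by blast
  qed
  show ?thesis
    using x(2)
  proof
    assume "Q = omega_limit S v x"
    then show ?thesis
      using omega_limit_meeting_transversal_essential[OF H assms(2,3) sc interior linj C(2) x(1)] meet by simp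
  next
    assume "Q = alpha_limit S v x"
    then show ?thesis
      using omega_limit_meeting_transversal_essential[OF H assms(2) flow_reverse[OF assms(3)] sc interior linj' C(2) x(1)] meet
      by (simp add: alpha_limit_reverse)
  qed
qed

end
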